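(* Let $\theta\in\mathbb{R}\setminus\{0\}$. Suppose that the backward Riccati recursion (given in the context) generating $P_t,\eta_t,\tilde P_{t+1},\tilde H_t,S_t$ is well-defined for $t=0,\ldots,N-1$, that $S_t\succ0$ for all $t=0,\ldots,N-1$, and that $\Xi_t:=\Sigma_t^{-1}-2\theta\tilde H_t\succ0$ for all $t=0,\ldots,N-1$. Then, for any initial value $x^{\mathsf{ini}}\in\mathbb{R}^n$, the optimal cost $J^*$ of the original risk-sensitive LQR problem and the optimal cost $\bar J^*$ of the input-randomized risk-sensitive LQR problem (both defined in the context) differ by $$\bar J^*-J^*=-\frac{1}{2\theta}\sum_{t=0}^{N-1}\log|\Xi_t\Sigma_t|>0.$$
   Context: Notation: $|A|$ is the determinant of a square matrix $A$; $\succ,\succeq$ denote the Loewner order on symmetric matrices; $v_{0:N}=[v_0^\top,\ldots,v_N^\top]^\top$; $\mathcal N(\mu,\Sigma)$ is the Gaussian distribution with mean $\mu$ and covariance $\Sigma$. Data: positive integers $n,m,N$; matrices $A_t\in\mathbb{R}^{n\times n}$, $B_t\in\mathbb{R}^{n\times m}$, symmetric $W_t\in\mathbb{R}^{n\times n}$ with $W_t\succ0$, $\Sigma_t\in\mathbb{R}^{m\times m}$ with $\Sigma_t\succ 0$, $R_t\in\mathbb{R}^{m\times m}$ with $R_t\succ0$ ($t=0,\ldots,N-1$), and $Q_t\in\mathbb{R}^{n\times n}$ with $Q_t\succeq0$ ($t=0,\ldots,N$); an initial state $x^{\mathsf{ini}}\in\mathbb{R}^n$. Noises: $w_t\sim\mathcal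 N(0,W_t)$ and $e_t\sim\mathcal N(0,\Sigma_t)$, $t=0,\ldots,N-1$, all mutually independent. Cost: $L_0(x_{0:N},u_{0:N-1}):=x_N^\top Q_Nx_N+\sum_{k=0}^{N-1}\left(x_k^\top Q_kx_k+u_k^\top R_ku_k\right)$. Original risk-sensitive LQR problem: $$J^*=\min_{u_{0:N-1}}\frac1\theta\log\mathbb{E}\left[e^{\theta L_0(x_{0:N},u_{0:N-1})}\right]\quad\text{subject to } x_{t+1}=A_tx_t+B_tu_t+w_t,\ x_0=x^{\mathsf{ini}}.$$ Input-randomized risk-sensitive LQR problem: $$\bar J^*=\min_{\bar u_{0:N-1}}\frac1\theta\log\mathbb{E}\left[e^{\theta L_0(x_{0:N},\,\bar u_{0:N-1}+e_{0:N-1})}\right]\quad\text{subject to } x_{t+1}=A_tx_t+B_t(\bar u_t+e_t)+w_t,\ x_0=x^{\mathsf{ini}}.$$ In both problems the decision at time $t$ ($u_t$ or $\bar u_t$, in $\mathbb{R}^m$) is a (measurable) function of the state history $x_0,\ldots,x_t$, chosen before $w_t$ (and $e_t$) are realized. An expectation equal to $+\infty$ (possible for $\theta>0$) is treated as infinite cost. Backward Riccati recursion (for the given $\theta$): $P_N=Q_N$, $\eta_N=0$, and for $t=N-1,\ldots,0$, $$S_t=W_t^{-1}-2\theta P_{t+1},\qquad \tilde P_{t+1}=P_{t+1}+2\theta P_{t+1}S_t^{-1}P_{t+1},\qquad \tilde H_t=R_t+B_t^\top\tilde P_{t+1}B_t,$$ $$P_t=Q_t+A_t^\top\tilde P_{t+1}A_t-A_t^\top\tilde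 P_{t+1}B_t\tilde H_t^{-1}B_t^\top\tilde P_{t+1}A_t,\qquad \eta_t=\eta_{t+1}-\frac{1}{2\theta}\log|S_tW_t|.$$ It is well-defined if all the inverses and logarithms occurring in it exist. *)

theory Defs
  imports "HOL-Probability.Probability"
begin

definition pos_semidef :: "real ^ 'n ^ 'n \<Rightarrow> bool" where
  "pos_semidef A \<longleftrightarrow> transpose A = A \<and> (\<forall>x. x \<bullet> (A *v x) \<ge> 0)"

definition pos_def :: "real ^ 'n ^ 'n \<Rightarrow> bool" where
  "pos_def A \<longleftrightarrow> transpose A = A \<and> (\<forall>x. x \<noteq> 0 \<longrightarrow> x \<bullet> (A *v x) > 0)"

text \<open>The covariance \<open>\<Sigma>\<close> has to be positive definite.\<close>

definition gaussian_density :: "real ^ 'n \<Rightarrow> real ^ 'n ^ 'n \<Rightarrow> real ^ 'n \<Rightarrow> real" where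
  "gaussian_density \<mu> \<Sigma> x =
     exp (- ((x - \<mu>) \<bullet> (matrix_inv \<Sigma> *v (x - \<mu>))) / 2) / sqrt ((2 * pi) ^ CARD('n) * det \<Sigma>)"

definition gaussian_rv :: "'a measure \<Rightarrow> ('a \<Rightarrow> real ^ 'n) \<Rightarrow> real ^ 'n \<Rightarrow> real ^ 'n ^ 'n \<Rightarrow> bool" where
  "gaussian_rv M X \<mu> \<Sigma> \<longleftrightarrow> distributed M lborel X (\<lambda>x. ennreal (gaussian_density \<mu> \<Sigma> x))"

text \<open>
  The two noise families have values in different types, so \<open>indep_vars\<close> does not apply to
  them jointly; mutual independence of all \<open>2 * N\<close> variables is expressed by the independence of
  the \<open>\<sigma>\<close>-algebras they generate, indexed by a disjoint sum.
\<close>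

definition mutually_indep_noises ::
  "'a measure \<Rightarrow> nat \<Rightarrow> (nat \<Rightarrow> 'a \<Rightarrow> real ^ 'n) \<Rightarrow> (nat \<Rightarrow> 'a \<Rightarrow> real ^ 'm) \<Rightarrow> bool" where
  "mutually_indep_noises M N w e \<longleftrightarrow>
     prob_space.indep_sets M
       (\<lambda>i. case i of
              Inl t \<Rightarrow> sets (vimage_algebra (space M) (w t) borel)
            | Inr t \<Rightarrow> sets (vimage_algebra (space M) (e t) borel))
       ({..<N} <+> {..<N})"

text \<open>
  A policy maps a time \<open>t\<close> and the state history up to \<open>t\<close>, an extensional function on
  \<open>{..t}\<close>, to the decision at time \<open>t\<close>.
\<close>

type_synonym ('n, 'm) policy = "nat \<Rightarrow> (nat \<Rightarrow> real ^ 'n) \<Rightarrow> real ^ 'm"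

definition admissible_policies :: "nat \<Rightarrow> ('n::finite, 'm::finite) policy set" where
  "admissible_policies N =
     {\<pi>. \<forall>t<N. \<pi> t \<in> borel_measurable (Pi\<^sub>M {..t} (\<lambda>_. borel))}"

text \<open>
  In \<open>state_history A B x0 v d t\<close>, the value \<open>v s h\<close> is the input actually applied to the system
  at time \<open>s\<close> after the history \<open>h\<close> (randomization included, if any), and \<open>d s\<close> is the realized
  process noise.
\<close>

primrec state_history ::
  "(nat \<Rightarrow> real ^ 'n ^ 'n) \<Rightarrow> (nat \<Rightarrow> real ^ 'm ^ 'n) \<Rightarrow> real ^ 'n \<Rightarrow> ('n::finite, 'm::finite) policy \<Rightarrow>
   (nat \<Rightarrow> real ^ 'n) \<Rightarrow> nat \<Rightarrow> (nat \<Rightarrow> real ^ 'n)" where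
  "state_history A B x0 v d 0 = (\<lambda>s\<in>{..0}. x0)"
| "state_history A B x0 v d (Suc t) =
     (let h = state_history A B x0 v d t
      in h(Suc t := A t *v h t + B t *v v t h + d t))"

definition lqr_state where
  "lqr_state A B x0 v d t = state_history A B x0 v d t t"

definition applied_input where
  "applied_input A B x0 v d t = v t (state_history A B x0 v d t)"

definition quadratic_cost ::
  "nat \<Rightarrow> (nat \<Rightarrow> real ^ 'n ^ 'n) \<Rightarrow> (nat \<Rightarrow> real ^ 'm ^ 'm) \<Rightarrow>
   (nat \<Rightarrow> real ^ 'n) \<Rightarrow> (nat \<Rightarrow> real ^ 'm) \<Rightarrow> real" where
  "quadratic_cost N Q R x u =
     x N \<bullet> (Q N *v x N) + (\<Sum>k<N. x k \<bullet> (Q k *v x k) + u k \<bullet> (R k *v u k))"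

definition risk_sensitive_cost :: "real \<Rightarrow> 'a measure \<Rightarrow> ('a \<Rightarrow> real) \<Rightarrow> ereal" where
  "risk_sensitive_cost \<theta> M L =
     (let E = (\<integral>\<^sup>+ \<omega>. ennreal (exp (\<theta> * L \<omega>)) \<partial>M)
      in if E = \<infinity> then \<infinity> else ereal (1 / \<theta> * ln (enn2real E)))"

definition original_cost where
  "original_cost \<theta> M N A B Q R x0 w \<pi> =
     risk_sensitive_cost \<theta> M (\<lambda>\<omega>.
       quadratic_cost N Q R
         (lqr_state A B x0 \<pi> (\<lambda>t. w t \<omega>))
         (applied_input A B x0 \<pi> (\<lambda>t. w t \<omega>)))"

definition randomized_cost where
  "randomized_cost \<theta> M N A B Q R x0 w e \<pi> =
     risk_sensitive_cost \<theta> M (\<lambda>\<omega>.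
       quadratic_cost N Q R
         (lqr_state A B x0 (\<lambda>t h. \<pi> t h + e t \<omega>) (\<lambda>t. w t \<omega>))
         (applied_input A B x0 (\<lambda>t h. \<pi> t h + e t \<omega>) (\<lambda>t. w t \<omega>)))"

definition original_optimal_cost where
  "original_optimal_cost \<theta> M N A B Q R x0 w =
     (INF \<pi>\<in>admissible_policies N. original_cost \<theta> M N A B Q R x0 w \<pi>)"

definition randomized_optimal_cost where
  "randomized_optimal_cost \<theta> M N A B Q R x0 w e =
     (INF \<pi>\<in>admissible_policies N. randomized_cost \<theta> M N A B Q R x0 w e \<pi>)"

text \<open>
  The sequences \<open>S\<close>, \<open>Pt\<close>, \<open>Ht\<close>, \<open>P\<close>, \<open>\<eta>\<close> are generated by the recursion. The tilde quantity
  with index \<open>t + 1\<close> is \<open>Pt (Suc t)\<close>. Since \<open>matrix_inv\<close> and \<open>ln\<close> are total, existence of the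
  inverses and logarithms is required separately in \<open>riccati_well_defined\<close>.
\<close>

definition riccati_recursion ::
  "real \<Rightarrow> nat \<Rightarrow> (nat \<Rightarrow> real ^ 'n ^ 'n) \<Rightarrow> (nat \<Rightarrow> real ^ 'm ^ 'n) \<Rightarrow> (nat \<Rightarrow> real ^ 'n ^ 'n) \<Rightarrow>
   (nat \<Rightarrow> real ^ 'n ^ 'n) \<Rightarrow> (nat \<Rightarrow> real ^ 'm ^ 'm) \<Rightarrow>
   (nat \<Rightarrow> real ^ 'n ^ 'n) \<Rightarrow> (nat \<Rightarrow> real) \<Rightarrow> (nat \<Rightarrow> real ^ 'n ^ 'n) \<Rightarrow>
   (nat \<Rightarrow> real ^ 'm ^ 'm) \<Rightarrow> (nat \<Rightarrow> real ^ 'n ^ 'n) \<Rightarrow> bool" where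
  "riccati_recursion \<theta> N A B W Q R P \<eta> Pt Ht S \<longleftrightarrow>
     P N = Q N \<and> \<eta> N = 0 \<and>
     (\<forall>t<N.
        S t = matrix_inv (W t) - (2 * \<theta>) *\<^sub>R P (Suc t) \<and>
        Pt (Suc t) = P (Suc t) + (2 * \<theta>) *\<^sub>R (P (Suc t) ** matrix_inv (S t) ** P (Suc t)) \<and>
        Ht t = R t + transpose (B t) ** Pt (Suc t) ** B t \<and>
        P t = Q t + transpose (A t) ** Pt (Suc t) ** A t
              - transpose (A t) ** Pt (Suc t) ** B t ** matrix_inv (Ht t)
                ** transpose (B t) ** Pt (Suc t) ** A t \<and>
        \<eta> t = \<eta> (Suc t) - 1 / (2 * \<theta>) * ln (det (S t ** W t)))"

definition riccati_well_defined ::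
  "nat \<Rightarrow> (nat \<Rightarrow> real ^ 'n ^ 'n) \<Rightarrow> (nat \<Rightarrow> real ^ 'm ^ 'm) \<Rightarrow> (nat \<Rightarrow> real ^ 'n ^ 'n) \<Rightarrow> bool" where
  "riccati_well_defined N W Ht S \<longleftrightarrow>
     (\<forall>t<N. invertible (W t) \<and> invertible (S t) \<and> invertible (Ht t) \<and> det (S t ** W t) > 0)"

end

theory Submission
  imports Defs
begin

text \<open>
  Both problems are solved by one dynamic program. If \<open>w\<close> is centred Gaussian with covariance \<open>W\<close> and
  \<open>S = W\<inverse> - 2 \<theta> P\<close> is positive definite, then completing the square in the exponent gives

    \<open>E exp (\<theta> (a + w)\<^sup>T P (a + w)) = det (S W) powr (- 1 / 2) * exp (\<theta> a\<^sup>T P' a)\<close>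

  with \<open>P' = P + 2 \<theta> P S\<inverse> P\<close> (\<open>gaussian_rv_exp_quadratic\<close>). Averaging over the process noise therefore
  replaces the Riccati matrix by its risk-adjusted version, at the price of a constant factor. The resulting
  cost is quadratic in the input, with the matrix \<open>H\<close> and its centre at the linear feedback
  (\<open>complete_square_input\<close>). In the original problem the deviation \<open>z\<close> from this feedback is weighted
  by \<open>H\<close>. In the randomized problem one also averages over \<open>e\<close>, and the same formula, with \<open>\<Xi>\<close> in the place
  of \<open>S\<close>, weights \<open>z\<close> by \<open>H + 2 \<theta> H \<Xi>\<inverse> H\<close> and contributes the additional factor
  \<open>det (\<Xi> \<Sigma>) powr (- 1 / 2)\<close>. Both weights are positive semidefinite (\<open>pos_semidef_risk_adjusted\<close>), so
  the same feedback \<open>z = 0\<close> is optimal in both problems, for either sign of \<open>\<theta>\<close>, and the Riccati matrices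
  agree. The optimal costs thus differ by the logarithms of the additional factors, divided by \<open>\<theta>\<close>.

  The optimality argument avoids conditional value functions. For a fixed policy, let \<open>G t\<close> be the
  expectation of the exponential of \<open>\<theta>\<close> times the cost before \<open>t\<close> plus the Riccati form at the state at
  time \<open>t\<close>. Independence of the noises at time \<open>t\<close> from the past yields \<open>G (t + 1)\<close> in terms of the past
  (\<open>value_moment_Suc\<close>), and comparison of \<open>G 0\<close> with \<open>G N\<close> bounds the cost of every policy from below by the
  cost of the feedback.

  The difference is positive because \<open>det (\<Xi> \<Sigma>) powr (- 1 / 2)\<close> is the mean of \<open>exp (\<theta> e\<^sup>T H e)\<close>, a random
  variable that is almost surely greater than \<open>1\<close> if \<open>\<theta> > 0\<close> and smaller than \<open>1\<close> if \<open>\<theta> < 0\<close>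
  (\<open>ln_det_sign\<close>).
\<close>

section \<open>Gaussian integrals on Euclidean space\<close>

lemma nn_integral_lborel_translate:
  fixes g :: "'a::euclidean_space \<Rightarrow> ennreal"
  assumes [measurable]: "g \<in> borel_measurable borel"
  shows "(\<integral>\<^sup>+x. g (x + a) \<partial>lborel) = (\<integral>\<^sup>+x. g x \<partial>lborel)"
proof -
  have "(\<integral>\<^sup>+x. g x \<partial>lborel) = (\<integral>\<^sup>+x. g x \<partial>distr lborel borel ((+) a))"
    by (simp add: lborel_distr_plus)
  also have "\<dots> = (\<integral>\<^sup>+x. g (x + a) \<partial>lborel)"
    by (subst nn_integral_distr) (auto simp: add.commute)
  finally show ?thesis by simp
qed

text \<open>
  Only translation invariance and Tonelli are needed: Lebesgue measure on the space is averaged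
  over the translations \<open>s *\<^sub>R b\<close> with \<open>s\<close> in a unit interval. Starting that interval at \<open>\<phi> x\<close>
  instead of at \<open>0\<close> turns the average of \<open>g\<close> into the average of the sheared \<open>g\<close>, and its length
  stays \<open>1\<close> because \<open>\<phi>\<close> is constant along \<open>b\<close>.
\<close>

lemma nn_integral_shear:
  fixes b :: "'a::euclidean_space" and g :: "'a \<Rightarrow> ennreal" and \<phi> :: "'a \<Rightarrow> real"
  assumes g[measurable]: "g \<in> borel_measurable borel" and \<phi>[measurable]: "\<phi> \<in> borel_measurable borel"
    and inv: "\<And>x t. \<phi> (x + t *\<^sub>R b) = \<phi> x"
  shows "(\<integral>\<^sup>+x. g (x + \<phi> x *\<^sub>R b) \<partial>lborel) = (\<integral>\<^sup>+x. g x \<partial>lborel)"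
proof -
  define J :: "real \<Rightarrow> ennreal" where "J = indicator {0..<1}"
  have J[measurable]: "J \<in> borel_measurable borel" by (simp add: J_def)
  have J1: "(\<integral>\<^sup>+s. J s \<partial>lborel) = 1" by (simp add: J_def)
  \<comment> \<open>both sides of the claim are the integral of \<open>K\<close>, in two orders of integration\<close>
  define K where "K x s = J (s - \<phi> x) * g (x + s *\<^sub>R b)" for x s
  have K[measurable]: "case_prod K \<in> borel_measurable (borel \<Otimes>\<^sub>M borel)"
    unfolding K_def split_beta by measurable
  have swap: "(\<integral>\<^sup>+x. \<integral>\<^sup>+s. f x s \<partial>lborel \<partial>lborel) = (\<integral>\<^sup>+s. \<integral>\<^sup>+x. f x s \<partial>lborel \<partial>lborel)"
    if [measurable]: "case_prod f \<in> borel_measurable (borel \<Otimes>\<^sub>M borel)" for f :: "'a \<Rightarrow> real \<Rightarrow> ennreal"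
    by (subst lborel_pair.Fubini'[of "\<lambda>x s. f x s"]) auto
  have inv': "\<phi> (x - t *\<^sub>R b) = \<phi> x" for x t using inv[of x "- t"] by simp
  have "(\<integral>\<^sup>+x. \<integral>\<^sup>+s. K x s \<partial>lborel \<partial>lborel) = (\<integral>\<^sup>+s. \<integral>\<^sup>+x. K x s \<partial>lborel \<partial>lborel)"
    by (rule swap) measurable
  also have "\<dots> = (\<integral>\<^sup>+s. \<integral>\<^sup>+x. K (x + - s *\<^sub>R b) s \<partial>lborel \<partial>lborel)"
    by (intro nn_integral_cong nn_integral_lborel_translate[symmetric]) measurable
  also have "\<dots> = (\<integral>\<^sup>+s. \<integral>\<^sup>+x. J (s - \<phi> x) * g x \<partial>lborel \<partial>lborel)"
    by (simp add: K_def inv')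
  also have "\<dots> = (\<integral>\<^sup>+x. \<integral>\<^sup>+s. J (s - \<phi> x) * g x \<partial>lborel \<partial>lborel)"
    by (rule swap[symmetric]) measurable
  also have "\<dots> = (\<integral>\<^sup>+x. g x \<partial>lborel)"
  proof (rule nn_integral_cong)
    fix x
    have "(\<integral>\<^sup>+s. J (s - \<phi> x) \<partial>lborel) = 1"
      using nn_integral_lborel_translate[OF J, of "- \<phi> x"] by (simp add: J1)
    then show "(\<integral>\<^sup>+s. J (s - \<phi> x) * g x \<partial>lborel) = g x"
      by (simp add: nn_integral_multc)
  qed
  finally have 1: "(\<integral>\<^sup>+x. \<integral>\<^sup>+s. K x s \<partial>lborel \<partial>lborel) = (\<integral>\<^sup>+x. g x \<partial>lborel)" .
  have "(\<integral>\<^sup>+x. \<integral>\<^sup>+s. K x s \<partial>lborel \<partial>lborel) = (\<integral>\<^sup>+x. \<integral>\<^sup>+s. K x (s + \<phi> x) \<partial>lborel \<partial>lborel)"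
    by (intro nn_integral_cong nn_integral_lborel_translate[symmetric]) measurable
  also have "\<dots> = (\<integral>\<^sup>+x. \<integral>\<^sup>+s. J s * g (x + (s + \<phi> x) *\<^sub>R b) \<partial>lborel \<partial>lborel)"
    by (simp add: K_def)
  also have "\<dots> = (\<integral>\<^sup>+s. \<integral>\<^sup>+x. J s * g (x + (s + \<phi> x) *\<^sub>R b) \<partial>lborel \<partial>lborel)"
    by (rule swap) measurable
  also have "\<dots> = (\<integral>\<^sup>+s. J s * (\<integral>\<^sup>+x. g (x + (s + \<phi> x) *\<^sub>R b) \<partial>lborel) \<partial>lborel)"
    by (simp add: nn_integral_cmult)
  also have "\<dots> = (\<integral>\<^sup>+s. J s * (\<integral>\<^sup>+x. g (x + \<phi> x *\<^sub>R b) \<partial>lborel) \<partial>lborel)"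
  proof (rule nn_integral_cong)
    fix s
    have "(\<integral>\<^sup>+x. g (x + (s + \<phi> x) *\<^sub>R b) \<partial>lborel)
        = (\<integral>\<^sup>+x. g ((x + s *\<^sub>R b) + \<phi> (x + s *\<^sub>R b) *\<^sub>R b) \<partial>lborel)"
      by (simp add: inv algebra_simps)
    also have "\<dots> = (\<integral>\<^sup>+x. g (x + \<phi> x *\<^sub>R b) \<partial>lborel)"
      by (rule nn_integral_lborel_translate[where g="\<lambda>x. g (x + \<phi> x *\<^sub>R b)"]) measurable
    finally show "J s * (\<integral>\<^sup>+x. g (x + (s + \<phi> x) *\<^sub>R b) \<partial>lborel)
        = J s * (\<integral>\<^sup>+x. g (x + \<phi> x *\<^sub>R b) \<partial>lborel)" by (rule arg_cong)
  qed
  also have "\<dots> = (\<integral>\<^sup>+x. g (x + \<phi> x *\<^sub>R b) \<partial>lborel)"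
    by (simp add: nn_integral_multc J1)
  finally show ?thesis using 1 by simp
qed

lemma nn_integral_gaussian_real:
  fixes c :: real
  assumes "c > 0"
  shows "(\<integral>\<^sup>+x. ennreal (exp (- (c * x\<^sup>2) / 2)) \<partial>lborel) = ennreal (sqrt (2 * pi / c))"
proof -
  define s where "s = 1 / sqrt c"
  have s: "s > 0" using assms by (simp add: s_def)
  have s2: "s\<^sup>2 = 1 / c" using assms by (simp add: s_def power_divide)
  have *: "exp (- (c * x\<^sup>2) / 2) = sqrt (2 * pi / c) * normal_density 0 s x" for x
    using assms by (simp add: normal_density_def s2 field_simps real_sqrt_divide real_sqrt_mult)
  have "(\<integral>\<^sup>+x. ennreal (exp (- (c * x\<^sup>2) / 2)) \<partial>lborel)
      = (\<integral>\<^sup>+x. ennreal (sqrt (2 * pi / c)) * ennreal (normal_density 0 s x) \<partial>lborel)"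
    unfolding * using assms by (simp add: ennreal_mult)
  also have "\<dots> = ennreal (sqrt (2 * pi / c)) * (\<integral>\<^sup>+x. ennreal (normal_density 0 s x) \<partial>lborel)"
    by (rule nn_integral_cmult) measurable
  also have "(\<integral>\<^sup>+x. ennreal (normal_density 0 s x) \<partial>lborel) = 1"
    using s by (subst nn_integral_eq_integral) auto
  finally show ?thesis by simp
qed

lemma quadratic_form_expand:
  fixes A :: "real^'n^'n"
  shows "x \<bullet> (A *v x) = (\<Sum>i\<in>UNIV. \<Sum>j\<in>UNIV. x$i * A$i$j * x$j)"
  by (simp add: inner_vec_def matrix_vector_mult_def sum_distrib_left mult_ac)

lemma axis_bilinear:
  fixes A :: "real^'n^'n"
  shows "axis i 1 \<bullet> (A *v axis j 1) = A$i$j"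
  by (simp add: inner_axis' matrix_vector_mul_component matrix_vector_mult_basis column_def)

lemma pos_def_diag: "pos_def A \<Longrightarrow> A$i$i > 0"
  unfolding pos_def_def using axis_bilinear[of i A i] by (metis axis_eq_0_iff zero_neq_one)

lemma transpose_inner: "(transpose A *v x) \<bullet> y = x \<bullet> (A *v y)" for A :: "real^'n^'m"
  by (simp add: dot_lmul_matrix)

lemma borel_measurable_matrix_vector_mult[measurable]:
  "(\<lambda>x. A *v x) \<in> borel_measurable borel" for A :: "real^'n^'m"
  by (intro borel_measurable_continuous_onI matrix_vector_mult_linear_continuous_on)

text \<open>
  Cholesky's elimination, carried out on the integral. \<open>J\<close> contains the coordinates that may still
  interact. To decouple \<open>m\<close>, complete the square in the coordinate \<open>m\<close>: a shear along the \<open>m\<close>-th axis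
  removes the off-diagonal entries of row and column \<open>m\<close>, preserves the integral, and has
  determinant \<open>1\<close>. Once all coordinates are decoupled, the integral is a product of
  one-dimensional Gaussian integrals.
\<close>

lemma gaussian_integral_decoupled:
  fixes A :: "real^'n^'n"
  assumes "finite J"
  shows "\<lbrakk>pos_def A; \<And>i j. i \<noteq> j \<Longrightarrow> i \<notin> J \<or> j \<notin> J \<Longrightarrow> A$i$j = 0\<rbrakk> \<Longrightarrow>
     det A > 0 \<and> (\<integral>\<^sup>+x. ennreal (exp (- (x \<bullet> (A *v x)) / 2)) \<partial>lborel) = ennreal (sqrt ((2 * pi)^CARD('n) / det A))"
  using assms
proof (induction J arbitrary: A rule: finite_induct)
  case empty
  have off: "A$i$j = 0" if "i \<noteq> j" for i j using empty.prems(2)[of i j] that by simp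
  have d: "det A = (\<Prod>i\<in>UNIV. A$i$i)" using off by (rule det_diagonal)
  have pos: "A$i$i > 0" for i using empty.prems(1) by (rule pos_def_diag)
  have q: "x \<bullet> (A *v x) = (\<Sum>i\<in>UNIV. A$i$i * (x$i)\<^sup>2)" for x
    unfolding quadratic_form_expand
  proof (intro sum.cong refl)
    fix i
    have "(\<Sum>j\<in>UNIV. x$i * A$i$j * x$j) = (\<Sum>j\<in>UNIV. if j = i then A$i$i * (x$i)\<^sup>2 else 0)"
      by (intro sum.cong) (auto simp: off power2_eq_square)
    then show "(\<Sum>j\<in>UNIV. x$i * A$i$j * x$j) = A$i$i * (x$i)\<^sup>2" by simp
  qed
  \<comment> \<open>the standard basis is indexed by itself in the product formula; \<open>ix\<close> recovers the coordinate\<close>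
  define ix :: "real^'n \<Rightarrow> 'n" where "ix = inv (\<lambda>i. axis i 1)"
  have inj: "inj (\<lambda>i::'n. axis i (1::real))" by (auto simp: inj_on_def axis_eq_axis)
  have ix: "ix (axis i 1) = i" for i unfolding ix_def by (rule inv_f_f[OF inj])
  have B: "(Basis :: (real^'n) set) = (\<lambda>i. axis i 1) ` UNIV" by (auto simp: Basis_vec_def)
  have e: "ennreal (exp (- (x \<bullet> (A *v x)) / 2)) = (\<Prod>b\<in>Basis. ennreal (exp (- (A$ix b$ix b * (x \<bullet> b)\<^sup>2) / 2)))" for x
    by (simp add: q B sum_negf[symmetric] sum_divide_distrib exp_sum prod_ennreal prod.reindex inj ix inner_axis)
  have "(\<integral>\<^sup>+x. ennreal (exp (- (x \<bullet> (A *v x)) / 2)) \<partial>lborel)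
     = (\<Prod>b\<in>(Basis :: (real^'n) set). \<integral>\<^sup>+x. ennreal (exp (- (A$ix b$ix b * x\<^sup>2) / 2)) \<partial>lborel)"
    unfolding e by (rule nn_integral_lborel_prod) auto
  also have "\<dots> = (\<Prod>i\<in>UNIV. ennreal (sqrt (2 * pi / A$i$i)))"
    using nn_integral_gaussian_real[OF pos] by (simp add: B prod.reindex inj ix)
  also have "\<dots> = ennreal (\<Prod>i\<in>UNIV. sqrt (2 * pi / A$i$i))"
    by (rule prod_ennreal) (simp add: pos less_imp_le)
  also have "(\<Prod>i\<in>UNIV. sqrt (2 * pi / A$i$i)) = sqrt ((2 * pi)^CARD('n) / det A)"
  proof -
    have "(\<Prod>i\<in>I. sqrt (f i)) = sqrt (\<Prod>i\<in>I. f i)" for f :: "'n \<Rightarrow> real" and I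
      by (induction I rule: infinite_finite_induct) (auto simp: real_sqrt_mult)
    then show ?thesis by (simp add: prod_dividef d)
  qed
  finally show ?case using pos by (simp add: d prod_pos)
next
  case (insert m J)
  \<comment> \<open>the coefficients of the conditional mean of coordinate \<open>m\<close> given the others, where the square is centred\<close>
  define \<phi> :: "real^'n" where "\<phi> = (\<chi> j. if j = m then 0 else - (A$m$j / A$m$m))"
  \<comment> \<open>the shear as a row operation on the identity, which makes its determinant obvious\<close>
  define T :: "real^'n^'n" where "T = (\<chi> k. if k = m then row m (mat 1) + \<phi> else row k (mat 1))"
  have mm: "A$m$m > 0" using insert.prems(1) by (rule pos_def_diag)
  have sym: "transpose A = A" using insert.prems(1) by (simp add: pos_def_def)
  have Tv: "T *v x = x + (\<phi> \<bullet> x) *\<^sub>R axis m 1" for x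
  proof -
    have "(T *v x)$k = (x + (\<phi> \<bullet> x) *\<^sub>R axis m 1)$k" for k
    proof -
      have r: "row k (mat 1 :: real^'n^'n) = axis k 1"
        by (simp add: row_def mat_def axis_def vec_eq_iff)
      have r': "row m (mat 1 :: real^'n^'n) = axis m 1"
        by (simp add: row_def mat_def axis_def vec_eq_iff)
      have "T$k = axis k 1 + (if k = m then \<phi> else 0)"
        by (simp add: T_def r r')
      then show ?thesis
        by (simp add: matrix_vector_mul_component inner_add_left inner_axis')
          (simp add: axis_def)
    qed
    then show ?thesis by (simp add: vec_eq_iff)
  qed
  have phim: "\<phi> \<bullet> axis j 1 = \<phi>$j" for j by (simp add: inner_axis)
  have phi0: "\<phi>$m = 0" by (simp add: \<phi>_def)
  have "\<phi> \<in> vec.span {row j (mat 1) |j. j \<noteq> m}"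
  proof -
    have "\<phi> = (\<Sum>j\<in>UNIV - {m}. \<phi>$j *s row j (mat 1))"
    proof -
      have "\<phi>$k = (\<Sum>j\<in>UNIV - {m}. \<phi>$j *s row j (mat 1))$k" for k
      proof -
        have "(\<Sum>j\<in>UNIV - {m}. \<phi>$j *s row j (mat 1 :: real^'n^'n))$k
            = (\<Sum>j\<in>UNIV - {m}. if j = k then \<phi>$j else 0)"
          unfolding sum_component by (intro sum.cong) (auto simp: row_def mat_def)
        then show ?thesis by (simp add: phi0)
      qed
      then show ?thesis unfolding vec_eq_iff by blast
    qed
    also have "\<dots> \<in> vec.span {row j (mat 1) |j. j \<noteq> m}"
      by (intro vec.span_sum vec.span_scale vec.span_base) auto
    finally show ?thesis .
  qed
  then have detT: "det T = 1"
    unfolding T_def by (subst det_row_span) (auto simp: det_I)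
  define A' where "A' = transpose T ** A ** T"
  have q: "x \<bullet> (A' *v y) = (T *v x) \<bullet> (A *v (T *v y))" for x y
    by (simp add: A'_def matrix_vector_mul_assoc[symmetric] dot_lmul_matrix inner_commute[of x]
        inner_commute[of "T *v x"])
  have detA': "det A' = det A" by (simp add: A'_def det_mul detT det_transpose)
  have pd: "pos_def A'"
    unfolding pos_def_def
  proof (intro conjI allI impI)
    show "transpose A' = A'" by (simp add: A'_def matrix_transpose_mul sym matrix_mul_assoc)
    fix x :: "real^'n" assume "x \<noteq> 0"
    have "invertible T" by (simp add: invertible_det_nz detT)
    then have "T *v x \<noteq> 0" using \<open>x \<noteq> 0\<close>
      by (metis matrix_left_invertible_ker invertible_def)
    then show "x \<bullet> (A' *v x) > 0" using insert.prems(1) by (simp add: q pos_def_def)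
  qed
  have ent: "A'$i$j = A$i$j + \<phi>$j * A$i$m + \<phi>$i * A$m$j + \<phi>$i * \<phi>$j * A$m$m" for i j
    unfolding axis_bilinear[symmetric, of A' i j] q Tv phim
    by (simp add: matrix_vector_right_distrib inner_add_left inner_add_right axis_bilinear
        matrix_vector_mult_scaleR algebra_simps)
  have symm: "A$i$j = A$j$i" for i j using sym by (metis transpose_def vec_lambda_beta)
  have off: "A'$i$j = 0" if "i \<noteq> j" "i \<notin> J \<or> j \<notin> J" for i j
  proof -
    have key: "A'$i$j = 0" if ij: "i \<noteq> j" "i \<notin> J" for i j
    proof (cases "i = m")
      case True then show ?thesis using ij mm by (simp add: ent phi0 \<phi>_def)
    next
      case False
      then have "A$i$k = 0" if "k \<noteq> i" for k using insert.prems(2)[of i k] ij that by auto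
      then show ?thesis using False ij by (simp add: ent \<phi>_def symm[of m i])
    qed
    have "A'$i$j = A'$j$i" by (simp add: ent symm)
    then show ?thesis using key[of i j] key[of j i] that by auto
  qed
  have IH: "det A' > 0" "(\<integral>\<^sup>+x. ennreal (exp (- (x \<bullet> (A' *v x)) / 2)) \<partial>lborel) = ennreal (sqrt ((2 * pi)^CARD('n) / det A'))"
    using insert.IH[OF pd off] by auto
  have "(\<integral>\<^sup>+x. ennreal (exp (- (x \<bullet> (A *v x)) / 2)) \<partial>lborel)
     = (\<integral>\<^sup>+x. ennreal (exp (- ((x + (\<phi> \<bullet> x) *\<^sub>R axis m 1) \<bullet> (A *v (x + (\<phi> \<bullet> x) *\<^sub>R axis m 1))) / 2)) \<partial>lborel)"
    by (rule nn_integral_shear[symmetric]) (auto simp: inner_add_right phim phi0)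
  also have "\<dots> = (\<integral>\<^sup>+x. ennreal (exp (- (x \<bullet> (A' *v x)) / 2)) \<partial>lborel)"
    by (simp add: q Tv)
  finally show ?case using IH detA' by simp
qed

lemma gaussian_integral:
  fixes A :: "real^'n^'n"
  assumes "pos_def A"
  shows "(\<integral>\<^sup>+x. ennreal (exp (- (x \<bullet> (A *v x)) / 2)) \<partial>lborel) = ennreal (sqrt ((2 * pi)^CARD('n) / det A))"
  using gaussian_integral_decoupled[of UNIV A] assms by simp

lemma det_pos_def: "pos_def A \<Longrightarrow> det A > 0"
  using gaussian_integral_decoupled[of UNIV A] by simp

section \<open>Exponentials of quadratic forms under a Gaussian law\<close>

lemma symmetric_form_commute:
  fixes A :: "real^'n^'n"
  assumes "transpose A = A"
  shows "x \<bullet> (A *v y) = y \<bullet> (A *v x)"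
  using assms by (metis transpose_inner inner_commute)

lemma pos_def_imp_pos_semidef: "pos_def A \<Longrightarrow> pos_semidef A"
  unfolding pos_def_def pos_semidef_def by (metis inner_zero_left less_imp_le order_refl)

lemma pos_def_invertible: "pos_def A \<Longrightarrow> invertible A"
  using det_pos_def[of A] by (simp add: invertible_det_nz)

lemma
  fixes A :: "real^'n^'n"
  assumes "pos_def A"
  shows matrix_inv_right: "A ** matrix_inv A = mat 1" and matrix_inv_left: "matrix_inv A ** A = mat 1"
  using someI_ex[OF pos_def_invertible[OF assms, unfolded invertible_def]]
  unfolding matrix_inv_def by auto

lemma matrix_inv_mult_vec:
  fixes A :: "real^'n^'n"
  assumes "pos_def A"
  shows "A *v (matrix_inv A *v x) = x"
  using matrix_inv_right[OF assms] by (simp add: matrix_vector_mul_assoc)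

lemma transpose_matrix_inv:
  fixes A :: "real^'n^'n"
  assumes "pos_def A"
  shows "transpose (matrix_inv A) = matrix_inv A"
proof -
  have "transpose (matrix_inv A) ** A = transpose (A ** matrix_inv A)"
    using assms by (simp add: matrix_transpose_mul pos_def_def)
  also have "\<dots> = mat 1" by (simp add: matrix_inv_right[OF assms])
  finally have "transpose (matrix_inv A) ** A ** matrix_inv A = matrix_inv A" by simp
  then show ?thesis by (simp add: matrix_mul_assoc[symmetric] matrix_inv_right[OF assms])
qed

lemma matrix_inv_nonneg_form:
  fixes A :: "real^'n^'n"
  assumes "pos_def A"
  shows "x \<bullet> (matrix_inv A *v x) \<ge> 0"
proof -
  have "x \<bullet> (matrix_inv A *v x) = (matrix_inv A *v x) \<bullet> (A *v (matrix_inv A *v x))"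
    by (simp add: matrix_inv_mult_vec[OF assms] inner_commute)
  also have "\<dots> \<ge> 0"
    using pos_def_imp_pos_semidef[OF assms] unfolding pos_semidef_def by blast
  finally show ?thesis .
qed

text \<open>
  The quadratic form that results from averaging \<open>exp (\<theta> * H)\<close> over Gaussian noise; the argument \<open>X\<close>
  is the precision matrix of the exponentially tilted noise.
\<close>

definition risk_adjusted :: "real \<Rightarrow> real^'n^'n \<Rightarrow> real^'n^'n \<Rightarrow> real^'n^'n" where
  "risk_adjusted \<theta> H X = H + (2 * \<theta>) *\<^sub>R (H ** matrix_inv X ** H)"

text \<open>
  Tilting a centred Gaussian exponent by \<open>\<theta> * H\<close> gives a Gaussian exponent with precision \<open>X\<close> and
  a shifted centre \<open>b\<close>; the value left at the centre is \<open>\<theta>\<close> times the risk-adjusted form.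
\<close>

lemma complete_square_gaussian:
  fixes H V :: "real^'n^'n" and a y :: "real^'n"
  assumes sym: "transpose H = H" and X: "X = matrix_inv V - (2 * \<theta>) *\<^sub>R H" and pd: "pos_def X"
  defines "b \<equiv> (2 * \<theta>) *\<^sub>R (matrix_inv X *v (H *v a))"
  shows "\<theta> * ((a + y) \<bullet> (H *v (a + y))) - y \<bullet> (matrix_inv V *v y) / 2
       = \<theta> * (a \<bullet> (risk_adjusted \<theta> H X *v a)) - (y - b) \<bullet> (X *v (y - b)) / 2"
proof -
  have Xsym: "transpose X = X" using pd by (simp add: pos_def_def)
  have Xb: "X *v b = (2 * \<theta>) *\<^sub>R (H *v a)"
    by (simp add: b_def matrix_vector_mult_scaleR matrix_inv_mult_vec[OF pd])
  have yXb: "y \<bullet> (X *v b) = 2 * \<theta> * (y \<bullet> (H *v a))" for y by (simp add: Xb)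
  have bXy: "b \<bullet> (X *v y) = 2 * \<theta> * (y \<bullet> (H *v a))"
    using symmetric_form_commute[OF Xsym, of b y] by (simp add: yXb)
  have yXy: "y \<bullet> (X *v y) = y \<bullet> (matrix_inv V *v y) - 2 * \<theta> * (y \<bullet> (H *v y))"
    by (simp add: X matrix_vector_mult_diff_rdistrib scaleR_matrix_vector_assoc[symmetric] inner_diff_right)
  have "a \<bullet> (risk_adjusted \<theta> H X *v a) = a \<bullet> (H *v a) + a \<bullet> (H *v b)"
    by (simp add: risk_adjusted_def b_def matrix_vector_mult_add_rdistrib scaleR_matrix_vector_assoc[symmetric]
        matrix_vector_mul_assoc[symmetric] matrix_vector_mult_scaleR inner_add_right)
  then have adj: "a \<bullet> (risk_adjusted \<theta> H X *v a) = a \<bullet> (H *v a) + b \<bullet> (H *v a)"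
    using symmetric_form_commute[OF sym, of a b] by simp
  show ?thesis
    unfolding adj
    by (simp add: matrix_vector_right_distrib matrix_vector_mult_diff_distrib inner_add_left inner_add_right
        inner_diff_left inner_diff_right yXb bXy yXy symmetric_form_commute[OF sym, of a y])
      (simp add: field_simps)
qed

lemma gaussian_exp_quadratic:
  fixes H V :: "real^'n^'n"
  assumes V: "pos_def V" and sym: "transpose H = H"
    and X: "X = matrix_inv V - (2 * \<theta>) *\<^sub>R H" and pd: "pos_def X"
  shows "(\<integral>\<^sup>+y. ennreal (gaussian_density 0 V y) * ennreal (exp (\<theta> * ((a + y) \<bullet> (H *v (a + y))))) \<partial>lborel)
       = ennreal (exp (\<theta> * (a \<bullet> (risk_adjusted \<theta> H X *v a))) / sqrt (det (X ** V)))"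
proof -
  define b where "b = (2 * \<theta>) *\<^sub>R (matrix_inv X *v (H *v a))"
  define E where "E = exp (\<theta> * (a \<bullet> (risk_adjusted \<theta> H X *v a)))"
  define Z where "Z = (2 * pi) ^ CARD('n)"
  have dV: "det V > 0" and dX: "det X > 0" using V pd by (simp_all add: det_pos_def)
  have Z: "Z > 0" by (simp add: Z_def)
  have "gaussian_density 0 V y * exp (\<theta> * ((a + y) \<bullet> (H *v (a + y))))
      = E / sqrt (Z * det V) * exp (- ((y - b) \<bullet> (X *v (y - b))) / 2)" for y
  proof -
    have "exp (- (y \<bullet> (matrix_inv V *v y)) / 2) * exp (\<theta> * ((a + y) \<bullet> (H *v (a + y))))
        = exp (\<theta> * ((a + y) \<bullet> (H *v (a + y))) - y \<bullet> (matrix_inv V *v y) / 2)"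
      by (simp add: exp_add[symmetric])
    also have "\<dots> = E * exp (- ((y - b) \<bullet> (X *v (y - b))) / 2)"
      by (simp add: complete_square_gaussian[OF sym X pd] b_def E_def exp_add[symmetric])
    finally show ?thesis by (simp add: gaussian_density_def Z_def)
  qed
  moreover have "ennreal (gaussian_density 0 V y) * ennreal c = ennreal (gaussian_density 0 V y * c)"
    if "c \<ge> 0" for c y
    using that by (intro ennreal_mult[symmetric]) (simp_all add: gaussian_density_def dV less_imp_le)
  ultimately have "(\<integral>\<^sup>+y. ennreal (gaussian_density 0 V y) * ennreal (exp (\<theta> * ((a + y) \<bullet> (H *v (a + y))))) \<partial>lborel)
      = (\<integral>\<^sup>+y. ennreal (E / sqrt (Z * det V)) * ennreal (exp (- ((y - b) \<bullet> (X *v (y - b))) / 2)) \<partial>lborel)"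
    using Z dV by (simp add: ennreal_mult[symmetric] E_def)
  also have "\<dots> = ennreal (E / sqrt (Z * det V)) * (\<integral>\<^sup>+y. ennreal (exp (- ((y - b) \<bullet> (X *v (y - b))) / 2)) \<partial>lborel)"
    by (rule nn_integral_cmult) measurable
  also have "(\<integral>\<^sup>+y. ennreal (exp (- ((y - b) \<bullet> (X *v (y - b))) / 2)) \<partial>lborel)
      = (\<integral>\<^sup>+y. ennreal (exp (- (y \<bullet> (X *v y)) / 2)) \<partial>lborel)"
    using nn_integral_lborel_translate[of "\<lambda>y. ennreal (exp (- (y \<bullet> (X *v y)) / 2))" "- b"] by simp
  also have "\<dots> = ennreal (sqrt (Z / det X))"
    unfolding Z_def by (rule gaussian_integral[OF pd])
  also have "ennreal (E / sqrt (Z * det V)) * ennreal (sqrt (Z / det X))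
      = ennreal (E / sqrt (Z * det V) * sqrt (Z / det X))"
    using Z dV dX by (intro ennreal_mult[symmetric]) (simp_all add: E_def)
  also have "E / sqrt (Z * det V) * sqrt (Z / det X) = E / sqrt (det (X ** V))"
    using Z dV dX by (simp add: det_mul real_sqrt_mult real_sqrt_divide field_simps)
  finally show ?thesis by (simp add: E_def)
qed

text \<open>
  For \<open>\<theta> \<ge> 0\<close> the correction term is a square. For \<open>\<theta> < 0\<close> the correction is nonpositive, and one evaluates
  the completed square at its centre \<open>b\<close>: the risk-adjusted form is then the minimum over \<open>y\<close> of
  \<open>(a + y) \<bullet> (H *v (a + y)) + y \<bullet> (matrix_inv V *v y) / (2 * \<bar>\<theta>\<bar>)\<close>, hence nonnegative.
\<close>

lemma pos_semidef_risk_adjusted: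
  fixes H V :: "real^'n^'n"
  assumes V: "pos_def V" and H: "pos_semidef H"
    and X: "X = matrix_inv V - (2 * \<theta>) *\<^sub>R H" and pd: "pos_def X"
  shows "pos_semidef (risk_adjusted \<theta> H X)"
  unfolding pos_semidef_def
proof (intro conjI allI)
  have sym: "transpose H = H" and nonneg: "x \<bullet> (H *v x) \<ge> 0" for x using H by (auto simp: pos_semidef_def)
  have "transpose (H ** matrix_inv X ** H) = H ** matrix_inv X ** H"
    by (simp add: matrix_transpose_mul sym transpose_matrix_inv[OF pd] matrix_mul_assoc)
  moreover have "transpose (A + c *\<^sub>R B) = transpose A + c *\<^sub>R transpose B" for A B :: "real^'n^'n" and c
    by (simp add: transpose_def vec_eq_iff)
  ultimately show "transpose (risk_adjusted \<theta> H X) = risk_adjusted \<theta> H X"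
    by (simp add: risk_adjusted_def sym)
  fix a
  show "a \<bullet> (risk_adjusted \<theta> H X *v a) \<ge> 0"
  proof (cases "\<theta> \<ge> 0")
    case True
    have "a \<bullet> (risk_adjusted \<theta> H X *v a) = a \<bullet> (H *v a) + 2 * \<theta> * (a \<bullet> (H *v (matrix_inv X *v (H *v a))))"
      by (simp add: risk_adjusted_def matrix_vector_mult_add_rdistrib scaleR_matrix_vector_assoc[symmetric]
          matrix_vector_mul_assoc[symmetric] inner_add_right)
    also have "a \<bullet> (H *v (matrix_inv X *v (H *v a))) = (H *v a) \<bullet> (matrix_inv X *v (H *v a))"
      using symmetric_form_commute[OF sym] by (metis inner_commute)
    finally show ?thesis using True nonneg[of a] matrix_inv_nonneg_form[OF pd, of "H *v a"] by simp
  next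
    case False
    define b where "b = (2 * \<theta>) *\<^sub>R (matrix_inv X *v (H *v a))"
    have "\<theta> * (a \<bullet> (risk_adjusted \<theta> H X *v a))
        = \<theta> * ((a + b) \<bullet> (H *v (a + b))) - b \<bullet> (matrix_inv V *v b) / 2"
      using complete_square_gaussian[OF sym X pd, of a b] by (simp add: b_def)
    also have "\<dots> \<le> 0"
      using False nonneg[of "a + b"] matrix_inv_nonneg_form[OF V, of b]
      by (smt (verit) divide_nonneg_pos mult_nonneg_nonneg mult_minus_left)
    finally show ?thesis using False by (simp add: mult_le_0_iff)
  qed
qed

lemma nn_integral_gaussian_density:
  fixes V :: "real^'n^'n"
  assumes "pos_def V"
  shows "(\<integral>\<^sup>+y. ennreal (gaussian_density 0 V y) \<partial>lborel) = 1"
proof -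
  have "pos_def (matrix_inv V)"
    unfolding pos_def_def
  proof (intro conjI allI impI)
    show "transpose (matrix_inv V) = matrix_inv V" by (rule transpose_matrix_inv[OF assms])
    fix x :: "real^'n" assume "x \<noteq> 0"
    then have "matrix_inv V *v x \<noteq> 0" using matrix_inv_mult_vec[OF assms, of x] by auto
    then have "(matrix_inv V *v x) \<bullet> (V *v (matrix_inv V *v x)) > 0" using assms by (simp add: pos_def_def)
    then show "x \<bullet> (matrix_inv V *v x) > 0" by (simp add: matrix_inv_mult_vec[OF assms] inner_commute)
  qed
  \<comment> \<open>no tilting: \<open>H = 0\<close>, so that \<open>X\<close> is the precision matrix of \<open>V\<close> itself\<close>
  then show ?thesis
    using gaussian_exp_quadratic[OF assms, of 0 "matrix_inv V" 0 0]
      matrix_inv_left[OF assms] by (simp add: det_I transpose_def zero_vec_def)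
qed

text \<open>
  \<open>1 / sqrt (det (X ** V))\<close> is the mean of \<open>exp (\<theta> * (y \<bullet> (H *v y)))\<close> under the centred Gaussian law
  with covariance \<open>V\<close>, and this random variable is almost surely on the same side of \<open>1\<close>, the side
  depending on the sign of \<open>\<theta>\<close>. Comparing integrals avoids diagonalising \<open>X\<close> and \<open>V\<close>.
\<close>

lemma ln_det_sign:
  fixes H V :: "real^'n^'n"
  assumes V: "pos_def V" and H: "pos_def H" and \<theta>: "\<theta> \<noteq> 0"
    and X: "X = matrix_inv V - (2 * \<theta>) *\<^sub>R H" and pd: "pos_def X"
  shows "- (1 / (2 * \<theta>)) * ln (det (X ** V)) > 0"
proof -
  define D where "D = det (X ** V)"
  have D: "D > 0" using V pd by (simp add: D_def det_mul det_pos_def)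
  define f where "f y = ennreal (gaussian_density 0 V y)" for y
  define g where "g y = f y * ennreal (exp (\<theta> * (y \<bullet> (H *v y))))" for y
  have f: "(\<integral>\<^sup>+y. f y \<partial>lborel) = 1"
    unfolding f_def by (rule nn_integral_gaussian_density[OF V])
  have g: "(\<integral>\<^sup>+y. g y \<partial>lborel) = ennreal (1 / sqrt D)"
    using gaussian_exp_quadratic[OF V _ X pd, of 0] H by (simp add: g_def f_def D_def pos_def_def)
  have [measurable]: "f \<in> borel_measurable borel" "g \<in> borel_measurable borel"
    unfolding f_def g_def gaussian_density_def by measurable
  have fpos: "gaussian_density 0 V y > 0" for y
    using det_pos_def[OF V] by (simp add: gaussian_density_def)
  have less: "(\<integral>\<^sup>+y. h y \<partial>lborel) < (\<integral>\<^sup>+y. k y \<partial>lborel)"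
    if [measurable]: "h \<in> borel_measurable borel" "k \<in> borel_measurable borel"
      and fin: "(\<integral>\<^sup>+y. h y \<partial>lborel) \<noteq> \<infinity>" and hk: "\<And>y. y \<noteq> 0 \<Longrightarrow> h y < k y" for h k :: "real^'n \<Rightarrow> ennreal"
  proof (rule nn_integral_less)
    have ne: "AE y in lborel. y \<noteq> (0 :: real^'n)" by (rule AE_lborel_singleton)
    show "AE y in lborel. h y \<le> k y"
      using ne by eventually_elim (use hk in \<open>auto intro: less_imp_le\<close>)
    show "\<not> (AE y in lborel. k y \<le> h y)"
    proof
      assume "AE y in lborel. k y \<le> h y"
      with ne have "AE y in (lborel :: (real^'n) measure). False"
        by eventually_elim (use hk in \<open>auto simp: not_le[symmetric]\<close>)
      then have "emeasure (lborel :: (real^'n) measure) UNIV = 0"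
        by (simp add: AE_iff_measurable[of UNIV])
      then show False by simp
    qed
  qed (use fin in auto)
  have Hpos: "y \<bullet> (H *v y) > 0" if "y \<noteq> 0" for y using H that by (simp add: pos_def_def)
  have gmul: "g y = ennreal (gaussian_density 0 V y * exp (\<theta> * (y \<bullet> (H *v y))))" for y
    using fpos[of y] by (simp add: g_def f_def ennreal_mult)
  show ?thesis
  proof (cases "\<theta> > 0")
    case True
    have "f y < g y" if "y \<noteq> 0" for y
      using fpos[of y] Hpos[OF that] True by (simp add: gmul f_def ennreal_less_iff)
    then have "1 < ennreal (1 / sqrt D)"
      using less[of f g] by (simp add: f g)
    then have "D < 1"
      using D by (simp add: ennreal_1[symmetric] ennreal_less_iff field_simps del: ennreal_1)
    then have "ln D < 0" using D by simp
    then show ?thesis using True by (simp add: D_def divide_neg_pos)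
  next
    case False
    then have neg: "\<theta> < 0" using \<theta> by simp
    have "g y < f y" if "y \<noteq> 0" for y
      using fpos[of y] Hpos[OF that] neg
      by (simp add: gmul f_def ennreal_less_iff mult_neg_pos)
    then have "ennreal (1 / sqrt D) < 1"
      using less[of g f] by (simp add: f g)
    then have "D > 1"
      using D by (simp add: ennreal_1[symmetric] ennreal_less_iff field_simps del: ennreal_1)
    then have "ln D > 0" by simp
    then show ?thesis using neg by (simp add: D_def divide_pos_neg)
  qed
qed

section \<open>One step of the Riccati recursion\<close>

text \<open>
  As a function of the input, the stage cost plus the cost-to-go \<open>F\<close> is a quadratic form
  centred at the optimal feedback
  \<open>u = - (K *v x)\<close>, and the value left over is the quadratic form of the Riccati matrix \<open>P\<close>.
\<close>

lemma complete_square_input: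
  fixes A F :: "real^'n^'n" and B :: "real^'m^'n" and H :: "real^'m^'m"
  assumes sym: "transpose F = F" and Hdef: "H = R + transpose B ** F ** B" and H: "pos_def H"
    and P: "P = Q + transpose A ** F ** A - transpose A ** F ** B ** matrix_inv H ** transpose B ** F ** A"
  defines "K \<equiv> matrix_inv H ** transpose B ** F ** A"
  shows "x \<bullet> (Q *v x) + u \<bullet> (R *v u) + (A *v x + B *v u) \<bullet> (F *v (A *v x + B *v u))
       = x \<bullet> (P *v x) + (u + K *v x) \<bullet> (H *v (u + K *v x))"
proof -
  define g where "g = transpose B *v (F *v (A *v x))"
  define k where "k = K *v x"
  have k: "k = matrix_inv H *v g"
    unfolding k_def K_def g_def matrix_vector_mul_assoc[symmetric] ..
  have Hk: "H *v k = g" by (simp add: k matrix_inv_mult_vec[OF H])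
  have kHu: "k \<bullet> (H *v u) = u \<bullet> g"
    using symmetric_form_commute[of H k u] H by (simp add: Hk pos_def_def)
  have tr: "y \<bullet> (transpose C *v z) = (C *v y) \<bullet> z" for C :: "real^'p^'q" and y z
    by (metis transpose_inner inner_commute)
  have P: "x \<bullet> (P *v x) = x \<bullet> (Q *v x) + (A *v x) \<bullet> (F *v (A *v x)) - k \<bullet> g"
  proof -
    have "x \<bullet> (P *v x) = x \<bullet> (Q *v x) + (A *v x) \<bullet> (F *v (A *v x)) - (A *v x) \<bullet> (F *v (B *v k))"
      by (simp add: P k_def K_def matrix_vector_mult_diff_rdistrib matrix_vector_mult_add_rdistrib
         inner_add_right inner_diff_right matrix_vector_mul_assoc[symmetric] tr del: transpose_matrix_vector)
    also have "(A *v x) \<bullet> (F *v (B *v k)) = k \<bullet> g"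
      using symmetric_form_commute[OF sym, of "A *v x" "B *v k"] by (simp add: g_def tr del: transpose_matrix_vector)
    finally show ?thesis .
  qed
  have uHu: "u \<bullet> (H *v u) = u \<bullet> (R *v u) + (B *v u) \<bullet> (F *v (B *v u))"
    by (simp add: Hdef matrix_vector_mult_add_rdistrib inner_add_right matrix_vector_mul_assoc[symmetric] tr del: transpose_matrix_vector)
  have ug: "u \<bullet> g = (B *v u) \<bullet> (F *v (A *v x))" by (simp add: g_def tr del: transpose_matrix_vector)
  show ?thesis
    unfolding k_def[symmetric] P
    by (simp add: matrix_vector_right_distrib inner_add_left inner_add_right Hk kHu uHu ug
       symmetric_form_commute[OF sym, of "A *v x" "B *v u"] inner_commute[of k g])
qed

lemma pos_def_input_weight:
  fixes B :: "real^'m^'n"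
  assumes R: "pos_def R" and F: "pos_semidef F"
  shows "pos_def (R + transpose B ** F ** B)"
  unfolding pos_def_def
proof (intro conjI allI impI)
  have "transpose (R + C) = transpose R + transpose C" for C :: "real^'m^'m"
    by (simp add: transpose_def vec_eq_iff)
  then show "transpose (R + transpose B ** F ** B) = R + transpose B ** F ** B"
    using R F by (simp add: pos_def_def pos_semidef_def matrix_transpose_mul matrix_mul_assoc)
  fix u :: "real^'m" assume "u \<noteq> 0"
  then have "u \<bullet> (R *v u) > 0" using R by (simp add: pos_def_def)
  moreover have "u \<bullet> (transpose B *v (F *v (B *v u))) \<ge> 0"
    using F by (metis transpose_inner inner_commute pos_semidef_def)
  ultimately show "u \<bullet> ((R + transpose B ** F ** B) *v u) > 0"
    by (simp add: matrix_vector_mult_add_rdistrib inner_add_right matrix_vector_mul_assoc[symmetric] del: transpose_matrix_vector)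
qed

text \<open>
  The form of \<open>P\<close> is the stage cost plus the cost-to-go under the optimal feedback, a sum of
  nonnegative terms.
\<close>

lemma pos_semidef_riccati_step:
  fixes A :: "real^'n^'n" and B :: "real^'m^'n"
  assumes Q: "pos_semidef Q" and R: "pos_def R" and F: "pos_semidef F"
    and H: "H = R + transpose B ** F ** B"
    and P: "P = Q + transpose A ** F ** A - transpose A ** F ** B ** matrix_inv H ** transpose B ** F ** A"
  shows "pos_semidef P"
  unfolding pos_semidef_def
proof (intro conjI allI)
  have Hpd: "pos_def H" unfolding H by (rule pos_def_input_weight[OF R F])
  have sym: "transpose F = F" "transpose Q = Q" using F Q by (auto simp: pos_semidef_def)
  have "transpose (C + D - G) = transpose C + transpose D - transpose G" for C D G :: "real^'n^'n"
    by (simp add: transpose_def vec_eq_iff)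
  then show "transpose P = P"
    by (simp add: P sym matrix_transpose_mul transpose_matrix_inv[OF Hpd] matrix_mul_assoc)
  fix x
  define u where "u = - ((matrix_inv H ** transpose B ** F ** A) *v x)"
  have "x \<bullet> (P *v x) = x \<bullet> (Q *v x) + u \<bullet> (R *v u) + (A *v x + B *v u) \<bullet> (F *v (A *v x + B *v u))"
    unfolding complete_square_input[OF sym(1) H Hpd P] by (simp add: u_def)
  also have "\<dots> \<ge> 0"
    using Q F pos_def_imp_pos_semidef[OF R] by (simp add: pos_semidef_def)
  finally show "x \<bullet> (P *v x) \<ge> 0" .
qed

section \<open>Integrating out an independent noise\<close>

text \<open>
  An independent random variable may be averaged over an independent copy. The information that is
  held fixed is a sub-\<open>\<sigma>\<close>-algebra rather than a random variable: it enters as the identity map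
  into the measurable space that the \<open>\<sigma>\<close>-algebra defines, so the integrand may use every quantity
  that is measurable for it.
\<close>

lemma (in prob_space) nn_integral_indep_copy:
  fixes E :: "'i \<Rightarrow> 'a set set"
  assumes indep: "indep_sets E I" and stable: "\<And>i. i \<in> I \<Longrightarrow> Int_stable (E i)"
    and J: "J \<subseteq> I" and i: "i \<in> I" "i \<notin> J"
    and Y[measurable]: "Y \<in> measurable M N" and YE: "\<And>S. S \<in> sets N \<Longrightarrow> Y -` S \<inter> space M \<in> E i"
    and g[measurable]: "case_prod g \<in> borel_measurable (sigma (space M) (\<Union>j\<in>J. E j) \<Otimes>\<^sub>M N)"
  shows "(\<integral>\<^sup>+\<omega>. g \<omega> (Y \<omega>) \<partial>M) = (\<integral>\<^sup>+\<omega>. \<integral>\<^sup>+\<omega>'. g \<omega> (Y \<omega>') \<partial>M \<partial>M)"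
proof -
  define F where "F = sigma (space M) (\<Union>j\<in>J. E j)"
  have Ev: "E j \<subseteq> events" if "j \<in> I" for j using indep that by (auto simp: indep_sets_def)
  have UE: "(\<Union>j\<in>J. E j) \<subseteq> Pow (space M)"
    using Ev J sets.space_closed by blast
  have setsF: "sets F = sigma_sets (space M) (\<Union>j\<in>J. E j)" and spF[simp]: "space F = space M"
    using UE by (simp_all add: F_def)
  have sub: "sets F \<subseteq> events"
    unfolding setsF using Ev J by (intro sets.sigma_sets_subset) auto
  have idF[measurable]: "(\<lambda>\<omega>. \<omega>) \<in> measurable M F"
    using sub by (intro measurableI) (auto simp: Int_absorb2 sets.sets_into_space dest: sets.sets_into_space)
  have [measurable]: "case_prod g \<in> borel_measurable (F \<Otimes>\<^sub>M N)" using g by (simp add: F_def)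
  have "indep_sets (\<lambda>b. sigma_sets (space M) (\<Union>j\<in>(if b then J else {i}). E j)) UNIV"
  proof (rule indep_sets_collect_sigma)
    show "indep_sets E (\<Union>b\<in>UNIV. if b then J else {i})"
      using indep by (rule indep_sets_mono_index[rotated]) (use J i in auto)
    show "disjoint_family (\<lambda>b. if b then J else {i})"
      using i by (auto simp: disjoint_family_on_def)
  qed (use stable J i in \<open>auto split: if_splits\<close>)
  then have ind: "indep_set (sigma_sets (space M) (\<Union>j\<in>J. E j)) (sigma_sets (space M) (E i))"
    unfolding indep_set_def by (rule indep_sets_mono_sets) (auto split: bool.split)
  interpret DF: prob_space "distr M F (\<lambda>\<omega>. \<omega>)" by (rule prob_space_distr) measurable
  interpret DY: prob_space "distr M N Y" by (rule prob_space_distr) measurable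
  have D: "distr M F (\<lambda>\<omega>. \<omega>) \<Otimes>\<^sub>M distr M N Y = distr M (F \<Otimes>\<^sub>M N) (\<lambda>\<omega>. (\<omega>, Y \<omega>))"
  proof (rule pair_measure_eqI)
    fix S T assume "S \<in> sets (distr M F (\<lambda>\<omega>. \<omega>))" "T \<in> sets (distr M N Y)"
    then have [measurable]: "S \<in> sets F" "T \<in> sets N" by auto
    have SM: "S \<subseteq> space M" using sets.sets_into_space[of S F] by simp
    have "prob (S \<inter> (Y -` T \<inter> space M)) = prob S * prob (Y -` T \<inter> space M)"
      using ind YE[of T] unfolding indep_sets2_eq by (simp add: setsF[symmetric])
    moreover have "(\<lambda>\<omega>. (\<omega>, Y \<omega>)) -` (S \<times> T) \<inter> space M = S \<inter> (Y -` T \<inter> space M)"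
      using SM by auto
    moreover have "(\<lambda>\<omega>. \<omega>) -` S \<inter> space M = S" using SM by auto
    ultimately show "emeasure (distr M F (\<lambda>\<omega>. \<omega>)) S * emeasure (distr M N Y) T
        = emeasure (distr M (F \<Otimes>\<^sub>M N) (\<lambda>\<omega>. (\<omega>, Y \<omega>))) (S \<times> T)"
      by (simp add: emeasure_distr emeasure_eq_measure ennreal_mult[symmetric])
  qed (auto intro: DF.sigma_finite_measure_axioms DY.sigma_finite_measure_axioms)
  have "(\<integral>\<^sup>+\<omega>. g \<omega> (Y \<omega>) \<partial>M) = (\<integral>\<^sup>+p. case_prod g p \<partial>distr M (F \<Otimes>\<^sub>M N) (\<lambda>\<omega>. (\<omega>, Y \<omega>)))"
    by (subst nn_integral_distr) auto
  also have "\<dots> = (\<integral>\<^sup>+p. case_prod g p \<partial>(distr M F (\<lambda>\<omega>. \<omega>) \<Otimes>\<^sub>M distr M N Y))"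
    by (simp add: D)
  also have "\<dots> = (\<integral>\<^sup>+\<omega>. \<integral>\<^sup>+y. g \<omega> y \<partial>distr M N Y \<partial>distr M F (\<lambda>\<omega>. \<omega>))"
    by (subst DY.nn_integral_fst[symmetric]) auto
  also have "\<dots> = (\<integral>\<^sup>+\<omega>. \<integral>\<^sup>+y. g \<omega> y \<partial>distr M N Y \<partial>M)"
    by (subst nn_integral_distr) auto
  also have "\<dots> = (\<integral>\<^sup>+\<omega>. \<integral>\<^sup>+\<omega>'. g \<omega> (Y \<omega>') \<partial>M \<partial>M)"
  proof (rule nn_integral_cong)
    fix \<omega> assume "\<omega> \<in> space M"
    then have [measurable]: "g \<omega> \<in> borel_measurable N"
      using measurable_Pair2[of "case_prod g" F N borel \<omega>] by simp
    show "(\<integral>\<^sup>+y. g \<omega> y \<partial>distr M N Y) = (\<integral>\<^sup>+\<omega>'. g \<omega> (Y \<omega>') \<partial>M)"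
      by (subst nn_integral_distr) auto
  qed
  finally show ?thesis .
qed

section \<open>Comparing risk-sensitive costs\<close>

text \<open>
  \<open>\<lambda>E. ln E / \<theta>\<close> is increasing for \<open>\<theta> > 0\<close> and decreasing for \<open>\<theta> < 0\<close>, so a lower bound on the cost is
  a lower, respectively an upper, bound on the exponential moment.
\<close>

lemma (in prob_space) risk_sensitive_cost_ge:
  assumes \<theta>: "\<theta> \<noteq> 0" and [measurable]: "L \<in> borel_measurable M"
    and pos: "\<theta> > 0 \<Longrightarrow> ennreal (exp (\<theta> * V)) \<le> (\<integral>\<^sup>+\<omega>. ennreal (exp (\<theta> * L \<omega>)) \<partial>M)"
    and neg: "\<theta> < 0 \<Longrightarrow> (\<integral>\<^sup>+\<omega>. ennreal (exp (\<theta> * L \<omega>)) \<partial>M) \<le> ennreal (exp (\<theta> * V))"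
  shows "ereal V \<le> risk_sensitive_cost \<theta> M L"
proof (cases "(\<integral>\<^sup>+\<omega>. ennreal (exp (\<theta> * L \<omega>)) \<partial>M) = \<infinity>")
  case True
  then show ?thesis by (simp add: risk_sensitive_cost_def)
next
  case False
  then obtain E where E: "(\<integral>\<^sup>+\<omega>. ennreal (exp (\<theta> * L \<omega>)) \<partial>M) = ennreal E" "E \<ge> 0"
    by (cases "\<integral>\<^sup>+\<omega>. ennreal (exp (\<theta> * L \<omega>)) \<partial>M") auto
  \<comment> \<open>this has to be excluded because \<open>ln 0 = 0\<close>\<close>
  have "E \<noteq> 0"
  proof
    assume "E = 0"
    then have "AE \<omega> in M. ennreal (exp (\<theta> * L \<omega>)) = 0"
      using E by (subst nn_integral_0_iff_AE[symmetric]) auto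
    then show False by simp
  qed
  then have "E > 0" using E by simp
  have "V \<le> 1 / \<theta> * ln E"
  proof (cases "\<theta> > 0")
    case True
    then have "exp (\<theta> * V) \<le> E" using pos E by simp
    then have "\<theta> * V \<le> ln E" using \<open>E > 0\<close> by (simp add: ln_ge_iff)
    then show ?thesis using True by (simp add: field_simps)
  next
    case False
    then have "\<theta> < 0" using \<theta> by simp
    then have "E \<le> exp (\<theta> * V)" using neg E by simp
    then have "ln E \<le> \<theta> * V" using \<open>E > 0\<close> by (metis ln_exp ln_le_cancel_iff exp_gt_zero)
    then show ?thesis using \<open>\<theta> < 0\<close> by (simp add: field_simps)
  qed
  then show ?thesis using E \<open>E > 0\<close> by (simp add: risk_sensitive_cost_def)
qed

lemma risk_sensitive_cost_eqI:
  assumes "\<theta> \<noteq> 0" "(\<integral>\<^sup>+\<omega>. ennreal (exp (\<theta> * L \<omega>)) \<partial>M) = ennreal (exp (\<theta> * V))"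
  shows "risk_sensitive_cost \<theta> M L = ereal V"
  using assms by (simp add: risk_sensitive_cost_def)

section \<open>Dynamic programming for randomized inputs\<close>

text \<open>
  Besides independence, all that the dynamic program needs about the noises is that an exponential of a
  quadratic form averages to a multiple of such an exponential, with \<open>\<sigma> t\<close> and \<open>F t\<close> for the process noise and \<open>\<rho> t\<close> and
  \<open>Hb t\<close> for the input noise. In this form the original problem is the instance with input noise \<open>0\<close>,
  where \<open>\<rho> t = 1\<close> and \<open>Hb t = H t\<close>, so both problems are solved at once.
\<close>

locale risk_sensitive_lqr = prob_space M
  for M :: "'a measure" +
  fixes \<theta> :: real and N :: nat
    and A Q P F :: "nat \<Rightarrow> real ^ 'n ^ 'n" and B :: "nat \<Rightarrow> real ^ 'm ^ 'n"
    and R H Hb :: "nat \<Rightarrow> real ^ 'm ^ 'm" and K :: "nat \<Rightarrow> real ^ 'n ^ 'm"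
    and x0 :: "real ^ 'n"
    and w :: "nat \<Rightarrow> 'a \<Rightarrow> real ^ 'n" and \<epsilon> :: "nat \<Rightarrow> 'a \<Rightarrow> real ^ 'm"
    and \<sigma> \<rho> :: "nat \<Rightarrow> real"
  assumes \<theta>: "\<theta> \<noteq> 0"
    and indep: "mutually_indep_noises M N w \<epsilon>"
    and w_meas: "\<And>t. t < N \<Longrightarrow> w t \<in> borel_measurable M"
    and \<epsilon>_meas: "\<And>t. t < N \<Longrightarrow> \<epsilon> t \<in> borel_measurable M"
    and w_exp: "\<And>t a. t < N \<Longrightarrow>
      (\<integral>\<^sup>+\<omega>. ennreal (exp (\<theta> * ((a + w t \<omega>) \<bullet> (P (Suc t) *v (a + w t \<omega>))))) \<partial>M)
        = ennreal (\<sigma> t) * ennreal (exp (\<theta> * (a \<bullet> (F t *v a))))"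
    and \<epsilon>_exp: "\<And>t a. t < N \<Longrightarrow>
      (\<integral>\<^sup>+\<omega>. ennreal (exp (\<theta> * ((a + \<epsilon> t \<omega>) \<bullet> (H t *v (a + \<epsilon> t \<omega>))))) \<partial>M)
        = ennreal (\<rho> t) * ennreal (exp (\<theta> * (a \<bullet> (Hb t *v a))))"
    and \<sigma>: "\<And>t. t < N \<Longrightarrow> \<sigma> t > 0" and \<rho>: "\<And>t. t < N \<Longrightarrow> \<rho> t > 0"
    and Hb: "\<And>t a. t < N \<Longrightarrow> a \<bullet> (Hb t *v a) \<ge> 0"
    and PN: "P N = Q N"
    and square: "\<And>t x u. t < N \<Longrightarrow>
      x \<bullet> (Q t *v x) + u \<bullet> (R t *v u) + (A t *v x + B t *v u) \<bullet> (F t *v (A t *v x + B t *v u))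
        = x \<bullet> (P t *v x) + (u + K t *v x) \<bullet> (H t *v (u + K t *v x))"
begin

definition noise_sets :: "nat + nat \<Rightarrow> 'a set set" where
  "noise_sets i = (case i of
      Inl t \<Rightarrow> sets (vimage_algebra (space M) (w t) borel)
    | Inr t \<Rightarrow> sets (vimage_algebra (space M) (\<epsilon> t) borel))"

definition known :: "(nat + nat) set \<Rightarrow> 'a measure" where
  "known J = sigma (space M) (\<Union>i\<in>J. noise_sets i)"

lemma indep_noise_sets: "indep_sets noise_sets ({..<N} <+> {..<N})"
  using indep by (simp add: mutually_indep_noises_def noise_sets_def[abs_def])

lemma noise_sets_subset: "noise_sets i \<subseteq> Pow (space M)"
  using sets.space_closed[of "vimage_algebra (space M) (w _) borel"]
    sets.space_closed[of "vimage_algebra (space M) (\<epsilon> _) borel"]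
  by (auto simp: noise_sets_def split: sum.split)

lemma space_known[simp]: "space (known J) = space M"
  unfolding known_def by (rule space_measure_of) (use noise_sets_subset in blast)

lemma sets_known: "sets (known J) = sigma_sets (space M) (\<Union>i\<in>J. noise_sets i)"
  unfolding known_def by (rule sets_measure_of) (use noise_sets_subset in blast)

lemma measurable_known_mono:
  assumes "f \<in> measurable (known J) L" "J \<subseteq> J'"
  shows "f \<in> measurable (known J') L"
proof -
  have "sets (known J) \<subseteq> sets (known J')"
    unfolding sets_known using assms(2) by (intro sigma_sets_mono') auto
  then show ?thesis
    using assms(1) measurable_mono[of L L "known J" "known J'"] by auto
qed

lemma measurable_known_imp:
  assumes "f \<in> measurable (known J) L" "J \<subseteq> {..<N} <+> {..<N}"
  shows "f \<in> measurable M L"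
proof -
  have "sets (known J) \<subseteq> events"
    unfolding sets_known using indep_noise_sets assms(2)
    by (intro sets.sigma_sets_subset) (auto simp: indep_sets_def)
  then show ?thesis
    using assms(1) measurable_mono[of L L "known J" M] by auto
qed

lemma w_known: "Inl t \<in> J \<Longrightarrow> w t \<in> borel_measurable (known J)"
  and \<epsilon>_known: "Inr t \<in> J \<Longrightarrow> \<epsilon> t \<in> borel_measurable (known J)"
proof -
  show "w t \<in> borel_measurable (known J)" if "Inl t \<in> J"
  proof (rule measurableI)
    fix S :: "(real^'n) set" assume "S \<in> sets borel"
    then have "w t -` S \<inter> space M \<in> noise_sets (Inl t)"
      by (simp add: noise_sets_def in_vimage_algebra)
    then show "w t -` S \<inter> space (known J) \<in> sets (known J)"
      using that unfolding sets_known space_known by (intro sigma_sets.Basic) blast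
  qed simp
  show "\<epsilon> t \<in> borel_measurable (known J)" if "Inr t \<in> J"
  proof (rule measurableI)
    fix S :: "(real^'m) set" assume "S \<in> sets borel"
    then have "\<epsilon> t -` S \<inter> space M \<in> noise_sets (Inr t)"
      by (simp add: noise_sets_def in_vimage_algebra)
    then show "\<epsilon> t -` S \<inter> space (known J) \<in> sets (known J)"
      using that unfolding sets_known space_known by (intro sigma_sets.Basic) blast
  qed simp
qed

lemma average_noise:
  fixes Y :: "'a \<Rightarrow> real^'p" and S T :: "real^'p^'p"
  assumes J: "J \<subseteq> {..<N} <+> {..<N}" and i: "i \<in> {..<N} <+> {..<N}" "i \<notin> J"
    and [measurable]: "c \<in> borel_measurable (known J)" "a \<in> borel_measurable (known J)"
      "Y \<in> borel_measurable M"
    and Yi: "\<And>D. D \<in> sets borel \<Longrightarrow> Y -` D \<inter> space M \<in> noise_sets i"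
    and Yexp: "\<And>a. (\<integral>\<^sup>+\<omega>. ennreal (exp (\<theta> * ((a + Y \<omega>) \<bullet> (S *v (a + Y \<omega>))))) \<partial>M)
                 = ennreal s * ennreal (exp (\<theta> * (a \<bullet> (T *v a))))"
  shows "(\<integral>\<^sup>+\<omega>. ennreal (exp (\<theta> * (c \<omega> + (a \<omega> + Y \<omega>) \<bullet> (S *v (a \<omega> + Y \<omega>))))) \<partial>M)
       = ennreal s * (\<integral>\<^sup>+\<omega>. ennreal (exp (\<theta> * (c \<omega> + a \<omega> \<bullet> (T *v a \<omega>)))) \<partial>M)"
proof -
  have split: "ennreal (exp (\<theta> * (c1 + c2))) = ennreal (exp (\<theta> * c1)) * ennreal (exp (\<theta> * c2))" for c1 c2
    by (simp add: ennreal_mult[symmetric] exp_add[symmetric] distrib_left)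
  define g where "g \<omega> y = ennreal (exp (\<theta> * (c \<omega> + (a \<omega> + y) \<bullet> (S *v (a \<omega> + y)))))" for \<omega> y
  have [measurable]: "c \<in> borel_measurable M" "a \<in> borel_measurable M"
    using J by (auto intro!: measurable_known_imp[OF _ J])
  have "case_prod g \<in> borel_measurable (known J \<Otimes>\<^sub>M borel)"
    unfolding g_def split_beta by measurable
  then have "(\<integral>\<^sup>+\<omega>. g \<omega> (Y \<omega>) \<partial>M) = (\<integral>\<^sup>+\<omega>. \<integral>\<^sup>+\<omega>'. g \<omega> (Y \<omega>') \<partial>M \<partial>M)"
    using J i Yi unfolding known_def
    by (intro nn_integral_indep_copy[OF indep_noise_sets])
      (auto simp: noise_sets_def sets.Int_stable split: sum.splits)
  also have "\<dots> = (\<integral>\<^sup>+\<omega>. ennreal s * ennreal (exp (\<theta> * (c \<omega> + a \<omega> \<bullet> (T *v a \<omega>)))) \<partial>M)"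
    unfolding g_def split by (simp add: nn_integral_cmult Yexp mult_ac)
  also have "\<dots> = ennreal s * (\<integral>\<^sup>+\<omega>. ennreal (exp (\<theta> * (c \<omega> + a \<omega> \<bullet> (T *v a \<omega>)))) \<partial>M)"
    by (rule nn_integral_cmult) measurable
  finally show ?thesis by (simp add: g_def)
qed

context
  fixes \<pi> :: "('n, 'm) policy"
  assumes \<pi>: "\<pi> \<in> admissible_policies N"
begin

definition hist :: "nat \<Rightarrow> 'a \<Rightarrow> nat \<Rightarrow> real^'n" where
  "hist t \<omega> = state_history A B x0 (\<lambda>t h. \<pi> t h + \<epsilon> t \<omega>) (\<lambda>t. w t \<omega>) t"

definition state :: "nat \<Rightarrow> 'a \<Rightarrow> real^'n" where "state t \<omega> = hist t \<omega> t"

definition decision :: "nat \<Rightarrow> 'a \<Rightarrow> real^'m" where "decision t \<omega> = \<pi> t (hist t \<omega>)"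

definition cost_before :: "nat \<Rightarrow> 'a \<Rightarrow> real" where
  "cost_before t \<omega> = (\<Sum>k<t. state k \<omega> \<bullet> (Q k *v state k \<omega>)
      + (decision k \<omega> + \<epsilon> k \<omega>) \<bullet> (R k *v (decision k \<omega> + \<epsilon> k \<omega>)))"

abbreviation past :: "nat \<Rightarrow> 'a measure" where "past t \<equiv> known ({..<t} <+> {..<t})"

lemma state_Suc: "state (Suc t) \<omega> = A t *v state t \<omega> + B t *v (decision t \<omega> + \<epsilon> t \<omega>) + w t \<omega>"
  by (simp add: state_def decision_def hist_def Let_def)

lemma hist_measurable: "t \<le> N \<Longrightarrow> hist t \<in> measurable (past t) (Pi\<^sub>M {..t} (\<lambda>_. borel))"
proof (induction t)
  case 0
  have "hist 0 = (\<lambda>\<omega>. \<lambda>s\<in>{..0}. x0)" by (simp add: hist_def fun_eq_iff)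
  also have "\<dots> \<in> measurable (past 0) (Pi\<^sub>M {..0} (\<lambda>_. borel))"
    by (rule measurable_restrict) simp
  finally show ?case .
next
  case (Suc t)
  then have t: "t < N" by simp
  have h[measurable]: "hist t \<in> measurable (past (Suc t)) (Pi\<^sub>M {..t} (\<lambda>_. borel))"
    using Suc by (intro measurable_known_mono[OF Suc.IH]) auto
  have [measurable]: "\<pi> t \<in> borel_measurable (Pi\<^sub>M {..t} (\<lambda>_. borel))"
    using \<pi> t by (simp add: admissible_policies_def)
  have [measurable]: "w t \<in> borel_measurable (past (Suc t))" "\<epsilon> t \<in> borel_measurable (past (Suc t))"
    by (auto intro: w_known \<epsilon>_known)
  have [measurable]: "(\<lambda>\<omega>. hist t \<omega> t) \<in> borel_measurable (past (Suc t))"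
    using measurable_compose[OF h measurable_component_singleton[of t]] by simp
  have "hist (Suc t) = (\<lambda>\<omega>. (hist t \<omega>)(Suc t := A t *v hist t \<omega> t + B t *v (\<pi> t (hist t \<omega>) + \<epsilon> t \<omega>) + w t \<omega>))"
    by (simp add: hist_def fun_eq_iff Let_def)
  also have "\<dots> \<in> measurable (past (Suc t)) (Pi\<^sub>M {..Suc t} (\<lambda>_. borel))"
    by (rule measurable_fun_upd[where J="{..t}"]) (auto simp: atMost_Suc)
  finally show ?case .
qed

lemma state_measurable: "t \<le> N \<Longrightarrow> state t \<in> borel_measurable (past t)"
  unfolding state_def[abs_def]
  using measurable_compose[OF hist_measurable measurable_component_singleton[of t]] by simp

lemma decision_measurable: "t < N \<Longrightarrow> decision t \<in> borel_measurable (past t)"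
  unfolding decision_def[abs_def]
  using measurable_compose[OF hist_measurable, of t "\<pi> t"] \<pi> by (simp add: admissible_policies_def)

lemma cost_before_measurable: "t \<le> N \<Longrightarrow> cost_before t \<in> borel_measurable (past t)"
  unfolding cost_before_def[abs_def]
proof (rule borel_measurable_sum)
  fix k assume t: "t \<le> N" and "k \<in> {..<t}"
  then have k: "k < t" by simp
  have [measurable]: "state k \<in> borel_measurable (past t)" "decision k \<in> borel_measurable (past t)"
    using k t by (auto intro: measurable_known_mono[OF state_measurable] measurable_known_mono[OF decision_measurable])
  have [measurable]: "\<epsilon> k \<in> borel_measurable (past t)" using k by (auto intro: \<epsilon>_known)
  show "(\<lambda>\<omega>. state k \<omega> \<bullet> (Q k *v state k \<omega>)
      + (decision k \<omega> + \<epsilon> k \<omega>) \<bullet> (R k *v (decision k \<omega> + \<epsilon> k \<omega>))) \<in> borel_measurable (past t)"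
    by measurable
qed

text \<open>
  The exponential moment of the cost up to time \<open>t\<close> together with the Riccati estimate of the remaining
  cost. At \<open>t = 0\<close> it is, up to the constant factors of the averages, the moment of the optimal cost; at
  \<open>t = N\<close> it is the moment of the cost of \<open>\<pi>\<close>.
\<close>

definition value_moment :: "nat \<Rightarrow> ennreal" where
  "value_moment t = (\<integral>\<^sup>+\<omega>. ennreal (exp (\<theta> * (cost_before t \<omega> + state t \<omega> \<bullet> (P t *v state t \<omega>)))) \<partial>M)"

text \<open>
  The process noise at time \<open>t\<close> is averaged out while the past and the input noise are fixed; then
  the square in the applied input is completed; then the input noise is averaged out while the past
  is fixed. The decision at time \<open>t\<close> survives only in \<open>z\<close>, its deviation from the optimal feedback.
\<close>

lemma value_moment_Suc:
  assumes t: "t < N"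
  defines "z \<equiv> \<lambda>\<omega>. decision t \<omega> + K t *v state t \<omega>"
  shows "value_moment (Suc t) = ennreal (\<sigma> t * \<rho> t) *
    (\<integral>\<^sup>+\<omega>. ennreal (exp (\<theta> * (cost_before t \<omega> + state t \<omega> \<bullet> (P t *v state t \<omega>) + z \<omega> \<bullet> (Hb t *v z \<omega>)))) \<partial>M)"
proof -
  \<comment> \<open>the noises that are realized before the process noise at time \<open>t\<close>\<close>
  define J where "J = {..<t} <+> {..<Suc t}"
  define u where "u \<omega> = decision t \<omega> + \<epsilon> t \<omega>" for \<omega>
  define a where "a \<omega> = A t *v state t \<omega> + B t *v u \<omega>" for \<omega>
  define c where "c \<omega> = cost_before t \<omega> + (state t \<omega> \<bullet> (Q t *v state t \<omega>) + u \<omega> \<bullet> (R t *v u \<omega>))" for \<omega>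
  have [measurable]: "state t \<in> borel_measurable (past t)" "decision t \<in> borel_measurable (past t)"
    "cost_before t \<in> borel_measurable (past t)"
    using t state_measurable decision_measurable cost_before_measurable by auto
  have sub: "{..<t} <+> {..<t} \<subseteq> J" by (auto simp: J_def)
  have [measurable]: "state t \<in> borel_measurable (known J)" "decision t \<in> borel_measurable (known J)"
    "cost_before t \<in> borel_measurable (known J)"
    by (auto intro!: measurable_known_mono[OF _ sub])
  have [measurable]: "\<epsilon> t \<in> borel_measurable (known J)"
    by (auto intro!: \<epsilon>_known simp: J_def)
  have [measurable]: "u \<in> borel_measurable (known J)" unfolding u_def by measurable
  have [measurable]: "a \<in> borel_measurable (known J)" "c \<in> borel_measurable (known J)"
    unfolding a_def c_def by measurable
  have "value_moment (Suc t)
      = (\<integral>\<^sup>+\<omega>. ennreal (exp (\<theta> * (c \<omega> + (a \<omega> + w t \<omega>) \<bullet> (P (Suc t) *v (a \<omega> + w t \<omega>))))) \<partial>M)"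
    by (simp add: value_moment_def cost_before_def c_def state_Suc a_def u_def)
  also have "\<dots> = ennreal (\<sigma> t) * (\<integral>\<^sup>+\<omega>. ennreal (exp (\<theta> * (c \<omega> + a \<omega> \<bullet> (F t *v a \<omega>)))) \<partial>M)"
  proof (rule average_noise)
    show "J \<subseteq> {..<N} <+> {..<N}" "Inl t \<in> {..<N} <+> {..<N}" "Inl t \<notin> J" using t by (auto simp: J_def)
  qed (use t in \<open>auto simp: w_meas w_exp noise_sets_def in_vimage_algebra\<close>)
  also have "(\<integral>\<^sup>+\<omega>. ennreal (exp (\<theta> * (c \<omega> + a \<omega> \<bullet> (F t *v a \<omega>)))) \<partial>M)
      = (\<integral>\<^sup>+\<omega>. ennreal (exp (\<theta> * ((cost_before t \<omega> + state t \<omega> \<bullet> (P t *v state t \<omega>))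
            + (z \<omega> + \<epsilon> t \<omega>) \<bullet> (H t *v (z \<omega> + \<epsilon> t \<omega>))))) \<partial>M)"
  proof (rule nn_integral_cong)
    fix \<omega>
    have "c \<omega> + a \<omega> \<bullet> (F t *v a \<omega>) = cost_before t \<omega> + (state t \<omega> \<bullet> (Q t *v state t \<omega>)
        + u \<omega> \<bullet> (R t *v u \<omega>) + a \<omega> \<bullet> (F t *v a \<omega>))" by (simp add: c_def)
    also have "\<dots> = cost_before t \<omega> + (state t \<omega> \<bullet> (P t *v state t \<omega>)
        + (u \<omega> + K t *v state t \<omega>) \<bullet> (H t *v (u \<omega> + K t *v state t \<omega>)))"
      unfolding a_def by (subst square[OF t]) (rule refl)
    also have "u \<omega> + K t *v state t \<omega> = z \<omega> + \<epsilon> t \<omega>" by (simp add: u_def z_def)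
    finally show "ennreal (exp (\<theta> * (c \<omega> + a \<omega> \<bullet> (F t *v a \<omega>))))
      = ennreal (exp (\<theta> * ((cost_before t \<omega> + state t \<omega> \<bullet> (P t *v state t \<omega>))
            + (z \<omega> + \<epsilon> t \<omega>) \<bullet> (H t *v (z \<omega> + \<epsilon> t \<omega>)))))" by (simp add: add.assoc)
  qed
  also have "\<dots> = ennreal (\<rho> t) * (\<integral>\<^sup>+\<omega>. ennreal (exp (\<theta> * ((cost_before t \<omega> + state t \<omega> \<bullet> (P t *v state t \<omega>))
      + z \<omega> \<bullet> (Hb t *v z \<omega>)))) \<partial>M)"
  proof (rule average_noise)
    show "{..<t} <+> {..<t} \<subseteq> {..<N} <+> {..<N}" "Inr t \<in> {..<N} <+> {..<N}" "Inr t \<notin> {..<t} <+> {..<t}"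
      using t by auto
    show "(\<lambda>\<omega>. cost_before t \<omega> + state t \<omega> \<bullet> (P t *v state t \<omega>)) \<in> borel_measurable (past t)"
      "z \<in> borel_measurable (past t)" unfolding z_def by measurable
  qed (use t in \<open>auto simp: \<epsilon>_meas \<epsilon>_exp noise_sets_def in_vimage_algebra\<close>)
  finally show ?thesis
    using \<sigma>[OF t] \<rho>[OF t] by (simp add: ennreal_mult less_imp_le mult.assoc)
qed

lemma value_moment_0: "value_moment 0 = ennreal (exp (\<theta> * (x0 \<bullet> (P 0 *v x0))))"
  by (simp add: value_moment_def cost_before_def state_def hist_def emeasure_space_1)

lemma gain_Suc:
  assumes "t < N"
  shows "ennreal (\<Prod>k<Suc t. \<sigma> k * \<rho> k) * v
       = ennreal (\<sigma> t * \<rho> t) * (ennreal (\<Prod>k<t. \<sigma> k * \<rho> k) * v)"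
proof -
  have "(\<Prod>k<Suc t. \<sigma> k * \<rho> k) = (\<sigma> t * \<rho> t) * (\<Prod>k<t. \<sigma> k * \<rho> k)"
    by (simp add: mult.commute)
  moreover have "0 \<le> \<sigma> k * \<rho> k" if "k \<le> t" for k
    using \<sigma>[of k] \<rho>[of k] that assms by simp
  then have "0 \<le> \<sigma> t * \<rho> t" "0 \<le> (\<Prod>k<t. \<sigma> k * \<rho> k)"
    by (auto intro!: prod_nonneg)
  ultimately show ?thesis by (simp only: ennreal_mult) (simp only: mult.assoc)
qed

text \<open>
  Dropping the nonnegative deviation term lowers the moment for \<open>\<theta> > 0\<close> and raises it for \<open>\<theta> < 0\<close>;
  there is nothing to drop for the optimal feedback. The moment thus changes by at least, at most or
  exactly the factor \<open>\<sigma> t * \<rho> t\<close> in each step.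
\<close>

lemma value_moment_lower:
  assumes "\<theta> > 0"
  shows "t \<le> N \<Longrightarrow> ennreal (\<Prod>k<t. \<sigma> k * \<rho> k) * value_moment 0 \<le> value_moment t"
proof (induction t)
  case (Suc t)
  then have t: "t < N" by simp
  have "ennreal (\<Prod>k<Suc t. \<sigma> k * \<rho> k) * value_moment 0
      = ennreal (\<sigma> t * \<rho> t) * (ennreal (\<Prod>k<t. \<sigma> k * \<rho> k) * value_moment 0)"
    by (rule gain_Suc[OF t])
  also have "\<dots> \<le> ennreal (\<sigma> t * \<rho> t) * value_moment t"
    using Suc by (intro mult_left_mono) auto
  also have "\<dots> \<le> value_moment (Suc t)"
    unfolding value_moment_Suc[OF t] value_moment_def[of t] using Hb[OF t] assms
    by (intro mult_left_mono nn_integral_mono ennreal_leI) auto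
  finally show ?case .
qed simp

lemma value_moment_upper:
  assumes "\<theta> < 0"
  shows "t \<le> N \<Longrightarrow> value_moment t \<le> ennreal (\<Prod>k<t. \<sigma> k * \<rho> k) * value_moment 0"
proof (induction t)
  case (Suc t)
  then have t: "t < N" by simp
  have "value_moment (Suc t) \<le> ennreal (\<sigma> t * \<rho> t) * value_moment t"
    unfolding value_moment_Suc[OF t] value_moment_def[of t] using Hb[OF t] assms
    by (intro mult_left_mono nn_integral_mono ennreal_leI) auto
  also have "\<dots> \<le> ennreal (\<sigma> t * \<rho> t) * (ennreal (\<Prod>k<t. \<sigma> k * \<rho> k) * value_moment 0)"
    using Suc by (intro mult_left_mono) auto
  also have "\<dots> = ennreal (\<Prod>k<Suc t. \<sigma> k * \<rho> k) * value_moment 0"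
    by (rule gain_Suc[OF t, symmetric])
  finally show ?case .
qed simp

lemma value_moment_eq:
  assumes "\<And>t h. t < N \<Longrightarrow> \<pi> t h = - (K t *v h t)"
  shows "t \<le> N \<Longrightarrow> value_moment t = ennreal (\<Prod>k<t. \<sigma> k * \<rho> k) * value_moment 0"
proof (induction t)
  case (Suc t)
  then have t: "t < N" by simp
  have "value_moment (Suc t) = ennreal (\<sigma> t * \<rho> t) * value_moment t"
    unfolding value_moment_Suc[OF t] value_moment_def[of t]
    by (simp add: decision_def state_def assms[OF t])
  also have "\<dots> = ennreal (\<sigma> t * \<rho> t) * (ennreal (\<Prod>k<t. \<sigma> k * \<rho> k) * value_moment 0)"
    using Suc by simp
  also have "\<dots> = ennreal (\<Prod>k<Suc t. \<sigma> k * \<rho> k) * value_moment 0"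
    by (rule gain_Suc[OF t, symmetric])
  finally show ?case .
qed simp

lemma quadratic_cost_eq:
  "quadratic_cost N Q R (lqr_state A B x0 (\<lambda>t h. \<pi> t h + \<epsilon> t \<omega>) (\<lambda>t. w t \<omega>))
      (applied_input A B x0 (\<lambda>t h. \<pi> t h + \<epsilon> t \<omega>) (\<lambda>t. w t \<omega>))
    = cost_before N \<omega> + state N \<omega> \<bullet> (P N *v state N \<omega>)"
  by (simp add: quadratic_cost_def lqr_state_def applied_input_def cost_before_def state_def
      decision_def hist_def PN)

lemma randomized_cost_eq:
  "randomized_cost \<theta> M N A B Q R x0 w \<epsilon> \<pi>
    = risk_sensitive_cost \<theta> M (\<lambda>\<omega>. cost_before N \<omega> + state N \<omega> \<bullet> (P N *v state N \<omega>))"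
  unfolding randomized_cost_def quadratic_cost_eq ..

lemma total_cost_measurable:
  "(\<lambda>\<omega>. cost_before N \<omega> + state N \<omega> \<bullet> (P N *v state N \<omega>)) \<in> borel_measurable M"
proof -
  have [measurable]: "cost_before N \<in> borel_measurable M" "state N \<in> borel_measurable M"
    by (auto intro: measurable_known_imp[OF cost_before_measurable] measurable_known_imp[OF state_measurable])
  show ?thesis by measurable
qed

end

definition optimal_value :: real where
  "optimal_value = x0 \<bullet> (P 0 *v x0) + (1 / \<theta>) * (\<Sum>t<N. ln (\<sigma> t) + ln (\<rho> t))"

lemma exp_optimal_value:
  "ennreal (exp (\<theta> * optimal_value))
    = ennreal (\<Prod>k<N. \<sigma> k * \<rho> k) * ennreal (exp (\<theta> * (x0 \<bullet> (P 0 *v x0))))"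
proof -
  have "(\<Prod>k<N. \<sigma> k * \<rho> k) = (\<Prod>k<N. exp (ln (\<sigma> k) + ln (\<rho> k)))"
    using \<sigma> \<rho> by (intro prod.cong) (auto simp: exp_add)
  also have "\<dots> = exp (\<Sum>k<N. ln (\<sigma> k) + ln (\<rho> k))" by (simp add: exp_sum)
  finally show ?thesis
    using \<theta> by (simp add: optimal_value_def distrib_left exp_add ennreal_mult[symmetric] mult.commute)
qed

lemma optimal_value_le:
  assumes \<pi>: "\<pi> \<in> admissible_policies N"
  shows "ereal optimal_value \<le> randomized_cost \<theta> M N A B Q R x0 w \<epsilon> \<pi>"
  unfolding randomized_cost_eq[OF \<pi>]
proof (rule risk_sensitive_cost_ge[OF \<theta> total_cost_measurable[OF \<pi>]])
  show "ennreal (exp (\<theta> * optimal_value)) \<le> (\<integral>\<^sup>+\<omega>. ennreal (exp (\<theta> *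
      (cost_before \<pi> N \<omega> + state \<pi> N \<omega> \<bullet> (P N *v state \<pi> N \<omega>)))) \<partial>M)" if "\<theta> > 0"
    using value_moment_lower[OF \<pi> that order_refl]
    unfolding value_moment_0[OF \<pi>] value_moment_def[OF \<pi>, of N] exp_optimal_value .
  show "(\<integral>\<^sup>+\<omega>. ennreal (exp (\<theta> *
      (cost_before \<pi> N \<omega> + state \<pi> N \<omega> \<bullet> (P N *v state \<pi> N \<omega>)))) \<partial>M) \<le> ennreal (exp (\<theta> * optimal_value))" if "\<theta> < 0"
    using value_moment_upper[OF \<pi> that order_refl]
    unfolding value_moment_0[OF \<pi>] value_moment_def[OF \<pi>, of N] exp_optimal_value .
qed

definition feedback :: "('n, 'm) policy" where
  "feedback t h = - (K t *v h t)"

lemma feedback_admissible: "feedback \<in> admissible_policies N"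
proof -
  have "feedback t \<in> borel_measurable (Pi\<^sub>M {..t} (\<lambda>_. borel))" for t
    unfolding feedback_def[abs_def] by measurable
  then show ?thesis by (simp add: admissible_policies_def)
qed

lemma feedback_cost: "randomized_cost \<theta> M N A B Q R x0 w \<epsilon> feedback = ereal optimal_value"
  unfolding randomized_cost_eq[OF feedback_admissible]
proof (rule risk_sensitive_cost_eqI[OF \<theta>])
  show "(\<integral>\<^sup>+\<omega>. ennreal (exp (\<theta> * (cost_before feedback N \<omega> + state feedback N \<omega> \<bullet> (P N *v state feedback N \<omega>)))) \<partial>M)
      = ennreal (exp (\<theta> * optimal_value))"
    using value_moment_eq[OF feedback_admissible _ order_refl]
    unfolding value_moment_0[OF feedback_admissible] value_moment_def[OF feedback_admissible, of N] exp_optimal_value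
    by (simp add: feedback_def)
qed

theorem randomized_optimal_cost_eq:
  "randomized_optimal_cost \<theta> M N A B Q R x0 w \<epsilon> = ereal optimal_value"
  unfolding randomized_optimal_cost_def
  using feedback_admissible feedback_cost optimal_value_le
  by (intro antisym INF_greatest) (metis INF_lower)+

end

section \<open>The cost of input randomization\<close>

lemma gaussian_rv_exp_quadratic:
  fixes X :: "'a \<Rightarrow> real^'n"
  assumes X: "gaussian_rv M X 0 V" and V: "pos_def V" and S: "transpose S = S"
    and Y: "Y = matrix_inv V - (2 * \<theta>) *\<^sub>R S" and pd: "pos_def Y"
  shows "(\<integral>\<^sup>+\<omega>. ennreal (exp (\<theta> * ((a + X \<omega>) \<bullet> (S *v (a + X \<omega>))))) \<partial>M)
       = ennreal (1 / sqrt (det (Y ** V))) * ennreal (exp (\<theta> * (a \<bullet> (risk_adjusted \<theta> S Y *v a))))"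
proof -
  have "(\<integral>\<^sup>+\<omega>. ennreal (exp (\<theta> * ((a + X \<omega>) \<bullet> (S *v (a + X \<omega>))))) \<partial>M)
      = (\<integral>\<^sup>+y. ennreal (gaussian_density 0 V y) * ennreal (exp (\<theta> * ((a + y) \<bullet> (S *v (a + y))))) \<partial>lborel)"
    using X unfolding gaussian_rv_def
    by (subst distributed_nn_integral[symmetric, where X=X and M=M and N=lborel]) auto
  also have "\<dots> = ennreal (exp (\<theta> * (a \<bullet> (risk_adjusted \<theta> S Y *v a))) / sqrt (det (Y ** V)))"
    by (rule gaussian_exp_quadratic[OF V S Y pd])
  finally show ?thesis
    using det_pos_def[OF V] det_pos_def[OF pd]
    by (simp add: ennreal_mult[symmetric] det_mul)
qed

lemma mutually_indep_noises_zero: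
  assumes "prob_space M" "mutually_indep_noises M N w e"
  shows "mutually_indep_noises M N w (\<lambda>_ _. 0 :: real^'m)"
proof -
  interpret prob_space M by fact
  have "sets (vimage_algebra (space M) (\<lambda>_. 0 :: real^'m) borel) \<subseteq> sets (vimage_algebra (space M) (e t) borel)" for t
  proof
    fix S assume "S \<in> sets (vimage_algebra (space M) (\<lambda>_. 0 :: real^'m) borel)"
    then have "S = {} \<or> S = space (vimage_algebra (space M) (e t) borel)"
      by (auto simp: sets_vimage_algebra2 split: if_splits)
    then show "S \<in> sets (vimage_algebra (space M) (e t) borel)"
      using sets.top[of "vimage_algebra (space M) (e t) borel"] by auto
  qed
  then show ?thesis
    using assms(2) unfolding mutually_indep_noises_def
    by (elim indep_sets_mono_sets) (auto split: sum.split)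
qed

theorem proposition1:
  fixes M :: "'a measure"
    and N :: nat
    and \<theta> :: real
    and A W Q P Pt S :: "nat \<Rightarrow> real ^ 'n ^ 'n"
    and B :: "nat \<Rightarrow> real ^ 'm ^ 'n"
    and \<Sigma> R Ht \<Xi> :: "nat \<Rightarrow> real ^ 'm ^ 'm"
    and \<eta> :: "nat \<Rightarrow> real"
    and x0 :: "real ^ 'n"
    and w :: "nat \<Rightarrow> 'a \<Rightarrow> real ^ 'n"
    and e :: "nat \<Rightarrow> 'a \<Rightarrow> real ^ 'm"
  assumes "N > 0" and "\<theta> \<noteq> 0"
    and "\<And>t. t < N \<Longrightarrow> pos_def (W t)"
    and "\<And>t. t < N \<Longrightarrow> pos_def (\<Sigma> t)"
    and "\<And>t. t < N \<Longrightarrow> pos_def (R t)"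
    and "\<And>t. t \<le> N \<Longrightarrow> pos_semidef (Q t)"
    and "prob_space M"
    and "\<And>t. t < N \<Longrightarrow> gaussian_rv M (w t) 0 (W t)"
    and "\<And>t. t < N \<Longrightarrow> gaussian_rv M (e t) 0 (\<Sigma> t)"
    and "mutually_indep_noises M N w e"
    and "riccati_recursion \<theta> N A B W Q R P \<eta> Pt Ht S"
    and "riccati_well_defined N W Ht S"
    and "\<And>t. t < N \<Longrightarrow> pos_def (S t)"
    and "\<And>t. t < N \<Longrightarrow> \<Xi> t = matrix_inv (\<Sigma> t) - (2 * \<theta>) *\<^sub>R Ht t"
    and "\<And>t. t < N \<Longrightarrow> pos_def (\<Xi> t)"
  shows "(\<exists>\<pi>\<in>admissible_policies N.
            original_cost \<theta> M N A B Q R x0 w \<pi> = original_optimal_cost \<theta> M N A B Q R x0 w) \<and>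
         (\<exists>\<pi>\<in>admissible_policies N.
            randomized_cost \<theta> M N A B Q R x0 w e \<pi> = randomized_optimal_cost \<theta> M N A B Q R x0 w e) \<and>
         \<bar>original_optimal_cost \<theta> M N A B Q R x0 w\<bar> \<noteq> \<infinity> \<and>
         \<bar>randomized_optimal_cost \<theta> M N A B Q R x0 w e\<bar> \<noteq> \<infinity> \<and>
         randomized_optimal_cost \<theta> M N A B Q R x0 w e - original_optimal_cost \<theta> M N A B Q R x0 w
           = ereal (- (1 / (2 * \<theta>)) * (\<Sum>t<N. ln (det (\<Xi> t ** \<Sigma> t)))) \<and>
         - (1 / (2 * \<theta>)) * (\<Sum>t<N. ln (det (\<Xi> t ** \<Sigma> t))) > 0"
proof -
  note \<theta> = assms(2) and W = assms(3) and \<Sigma> = assms(4) and R = assms(5) and Q = assms(6)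
    and wd = assms(8) and ed = assms(9) and indep = assms(10) and S = assms(13) and Xi = assms(14)
    and pdXi = assms(15)
  interpret prob_space M by (rule assms(7))
  have PN: "P N = Q N"
    and Sdef: "\<And>t. t < N \<Longrightarrow> S t = matrix_inv (W t) - (2 * \<theta>) *\<^sub>R P (Suc t)"
    and Pt: "\<And>t. t < N \<Longrightarrow> Pt (Suc t) = risk_adjusted \<theta> (P (Suc t)) (S t)"
    and Ht: "\<And>t. t < N \<Longrightarrow> Ht t = R t + transpose (B t) ** Pt (Suc t) ** B t"
    and P: "\<And>t. t < N \<Longrightarrow> P t = Q t + transpose (A t) ** Pt (Suc t) ** A t
              - transpose (A t) ** Pt (Suc t) ** B t ** matrix_inv (Ht t)
                ** transpose (B t) ** Pt (Suc t) ** A t"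
    using assms(11) unfolding riccati_recursion_def risk_adjusted_def by blast+
  have Pt_psd_step: "pos_semidef (Pt (Suc t))" if "t < N" "pos_semidef (P (Suc t))" for t
    unfolding Pt[OF that(1)]
    by (rule pos_semidef_risk_adjusted[OF W[OF that(1)] that(2) Sdef[OF that(1)] S[OF that(1)]])
  have P_psd: "pos_semidef (P t)" if "t \<le> N" for t
    using that
  proof (induction rule: inc_induct)
    case base
    show ?case unfolding PN by (rule Q) simp
  next
    case (step t)
    then have t: "t < N" by simp
    show ?case
      by (rule pos_semidef_riccati_step[OF Q[OF less_imp_le[OF t]] R[OF t] Pt_psd_step[OF t step.IH] Ht[OF t] P[OF t]])
  qed
  have Pt_psd: "pos_semidef (Pt (Suc t))" if "t < N" for t
    using that P_psd[of "Suc t"] by (intro Pt_psd_step) auto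
  have Ht_pd: "pos_def (Ht t)" if "t < N" for t
    unfolding Ht[OF that] by (rule pos_def_input_weight[OF R[OF that] Pt_psd[OF that]])
  have sym: "transpose C = C" if "pos_semidef C" for C :: "real^'k^'k"
    using that by (simp add: pos_semidef_def)
  define K where "K t = matrix_inv (Ht t) ** transpose (B t) ** Pt (Suc t) ** A t" for t
  define \<sigma> where "\<sigma> t = 1 / sqrt (det (S t ** W t))" for t
  define \<rho> where "\<rho> t = 1 / sqrt (det (\<Xi> t ** \<Sigma> t))" for t
  have \<sigma>: "\<sigma> t > 0" if "t < N" for t
    using W[OF that] S[OF that] by (simp add: \<sigma>_def det_mul det_pos_def)
  have det\<rho>: "det (\<Xi> t ** \<Sigma> t) > 0" if "t < N" for t
    using \<Sigma>[OF that] pdXi[OF that] by (simp add: det_mul det_pos_def)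
  have \<rho>: "\<rho> t > 0" if "t < N" for t
    using det\<rho>[OF that] by (simp add: \<rho>_def)
  have w_meas: "w t \<in> borel_measurable M" if "t < N" for t
    using distributed_measurable[OF wd[OF that, unfolded gaussian_rv_def]] by simp
  have e_meas: "e t \<in> borel_measurable M" if "t < N" for t
    using distributed_measurable[OF ed[OF that, unfolded gaussian_rv_def]] by simp
  have w_exp: "(\<integral>\<^sup>+\<omega>. ennreal (exp (\<theta> * ((a + w t \<omega>) \<bullet> (P (Suc t) *v (a + w t \<omega>))))) \<partial>M)
        = ennreal (\<sigma> t) * ennreal (exp (\<theta> * (a \<bullet> (Pt (Suc t) *v a))))" if t: "t < N" for t a
    unfolding \<sigma>_def Pt[OF t]
    by (rule gaussian_rv_exp_quadratic[OF wd[OF t] W[OF t] sym[OF P_psd] Sdef[OF t] S[OF t]])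
      (use t in simp)
  have e_exp: "(\<integral>\<^sup>+\<omega>. ennreal (exp (\<theta> * ((a + e t \<omega>) \<bullet> (Ht t *v (a + e t \<omega>))))) \<partial>M)
        = ennreal (\<rho> t) * ennreal (exp (\<theta> * (a \<bullet> (risk_adjusted \<theta> (Ht t) (\<Xi> t) *v a))))"
    if t: "t < N" for t a
    unfolding \<rho>_def
    by (rule gaussian_rv_exp_quadratic[OF ed[OF t] \<Sigma>[OF t] sym[OF pos_def_imp_pos_semidef] Xi[OF t] pdXi[OF t]])
      (rule Ht_pd[OF t])
  have square: "x \<bullet> (Q t *v x) + u \<bullet> (R t *v u) + (A t *v x + B t *v u) \<bullet> (Pt (Suc t) *v (A t *v x + B t *v u))
        = x \<bullet> (P t *v x) + (u + K t *v x) \<bullet> (Ht t *v (u + K t *v x))" if t: "t < N" for t x u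
    unfolding K_def
    by (rule complete_square_input[OF sym[OF Pt_psd[OF t]] Ht[OF t] Ht_pd[OF t] P[OF t]])
  \<comment> \<open>without input noise, averaging changes nothing\<close>
  interpret orig: risk_sensitive_lqr M \<theta> N A Q P "\<lambda>t. Pt (Suc t)" B R Ht Ht K x0 w "\<lambda>_ _. 0" \<sigma> "\<lambda>_. 1"
  proof
    show "mutually_indep_noises M N w (\<lambda>_ _. 0 :: real^'m)"
      by (rule mutually_indep_noises_zero[OF assms(7) indep])
    show "a \<bullet> (Ht t *v a) \<ge> 0" if "t < N" for t a
      using pos_def_imp_pos_semidef[OF Ht_pd[OF that]] by (simp add: pos_semidef_def)
  qed (use \<theta> w_meas w_exp \<sigma> PN square in \<open>simp_all add: emeasure_space_1\<close>)
  interpret rand: risk_sensitive_lqr M \<theta> N A Q P "\<lambda>t. Pt (Suc t)" B R Ht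
      "\<lambda>t. risk_adjusted \<theta> (Ht t) (\<Xi> t)" K x0 w e \<sigma> \<rho>
  proof
    show "a \<bullet> (risk_adjusted \<theta> (Ht t) (\<Xi> t) *v a) \<ge> 0" if "t < N" for t a
      using pos_semidef_risk_adjusted[OF \<Sigma>[OF that] pos_def_imp_pos_semidef[OF Ht_pd[OF that]] Xi[OF that] pdXi[OF that]]
      by (simp add: pos_semidef_def)
  qed (use \<theta> indep w_meas e_meas w_exp e_exp \<sigma> \<rho> PN square in simp_all)
  have orig_cost: "original_cost \<theta> M N A B Q R x0 w = randomized_cost \<theta> M N A B Q R x0 w (\<lambda>_ _. 0)"
    by (simp add: fun_eq_iff original_cost_def randomized_cost_def)
  then have orig_opt: "original_optimal_cost \<theta> M N A B Q R x0 w = ereal orig.optimal_value"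
    using orig.randomized_optimal_cost_eq
    by (simp add: original_optimal_cost_def randomized_optimal_cost_def)
  have ln\<rho>: "ln (\<rho> t) = - ln (det (\<Xi> t ** \<Sigma> t)) / 2" if "t < N" for t
    using det\<rho>[OF that] by (simp add: \<rho>_def ln_div ln_sqrt)
  have "(1 / \<theta>) * (\<Sum>t<N. ln (\<rho> t)) = - (1 / (2 * \<theta>)) * (\<Sum>t<N. ln (det (\<Xi> t ** \<Sigma> t)))"
    by (simp add: ln\<rho> sum_negf sum_divide_distrib[symmetric])
  then have diff: "rand.optimal_value - orig.optimal_value = - (1 / (2 * \<theta>)) * (\<Sum>t<N. ln (det (\<Xi> t ** \<Sigma> t)))"
    unfolding rand.optimal_value_def orig.optimal_value_def
    by (simp add: sum.distrib distrib_left)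
  have "(\<Sum>t<N. - (1 / (2 * \<theta>)) * ln (det (\<Xi> t ** \<Sigma> t))) > 0"
    using ln_det_sign[OF \<Sigma> Ht_pd \<theta> Xi pdXi] assms(1) by (intro sum_pos) auto
  then have pos: "- (1 / (2 * \<theta>)) * (\<Sum>t<N. ln (det (\<Xi> t ** \<Sigma> t))) > 0"
    by (simp only: sum_distrib_left)
  show ?thesis
    using orig.feedback_admissible orig.feedback_cost rand.feedback_admissible rand.feedback_cost
      rand.randomized_optimal_cost_eq orig_cost orig_opt diff pos
    by (intro conjI) auto
qed

end
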